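(* Let $\Omega$ be a connected open subset of $\mathbb C^n$. The space of Lagrangian pluriharmonic functions on $\Omega$ consists of the traceless hermitian degree-2 polynomials, i.e. the functions of the form $$h(z)=c+\sum_{k=1}^n(b_kz_k+\overline b_k\overline z_k)+\frac12\sum_{i,j=1}^na_{ij}z_i\overline z_j$$ where $c\in\mathbb R$, $b\in\mathbb C^n$, and $A=(a_{ij})$ is a complex $n\times n$ matrix with $A=\overline A^t$ and $\mathrm{tr}A=0$.
   Context: A real $n$-plane $W\subset\mathbb C^n=(\mathbb R^{2n},J,\langle\cdot,\cdot\rangle)$ is Lagrangian if $JW=W^\perp$; $\mathrm{LAG}$ is the set of these. $\mathcal P(\mathrm{LAG})=\{A\in\mathrm{Sym}^2_{\mathbb R}(\mathbb C^n):\mathrm{tr}(A|_W)\ge0\ \forall\,W\in\mathrm{LAG}\}$, where $\mathrm{Sym}^2_{\mathbb R}(\mathbb C^n)$ is the space of real symmetric bilinear forms on $\mathbb R^{2n}$. An upper semi-continuous function $u:\Omega\to[-\infty,\infty)$ is Lagrangian plurisubharmonic if for each $x\in\Omega$ and each smooth $\varphi$ defined near $x$ with $u\le\varphi$ near $x$ and equality at $x$, one has $D^2_x\varphi\in\mathcal P(\mathrm{LAG})$. A continuous function $h:\Omega\to\mathbb R$ is Lagrangian pluriharmonic if both $h$ and $-h$ are Lagrangian plurisubharmonic. *)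

theory Defs
  imports "HOL-Analysis.Analysis"
begin

text \<open>
  Complex \<open>n\<close>-space is the type \<open>complex^'n\<close> with \<open>n = CARD('n)\<close>. Its type-class inner product
  is the real Euclidean one, so \<open>subspace\<close>, \<open>dim\<close>, \<open>orthogonal\<close>, \<open>bilinear\<close> and the
  Frechet derivative below all refer to the underlying real \<open>2n\<close>-dimensional space.
\<close>

definition cplx_J :: "complex^'n \<Rightarrow> complex^'n"
  where "cplx_J z = (\<chi> k. \<i> * z $ k)"

definition LAG :: "(complex^'n) set set"
  where "LAG = {W. subspace W \<and> dim W = CARD('n) \<and> cplx_J ` W = orthogonal_comp W}"

definition Sym2 :: "('a::euclidean_space \<Rightarrow> 'a \<Rightarrow> real) set"
  where "Sym2 = {A. bilinear A \<and> (\<forall>v w. A v w = A w v)}"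

definition orthonormal_basis_of :: "'a::euclidean_space set \<Rightarrow> 'a set \<Rightarrow> bool"
  where "orthonormal_basis_of W B \<longleftrightarrow>
    pairwise orthogonal B \<and> (\<forall>e\<in>B. norm e = 1) \<and> span B = W"

text \<open>The choice of basis is immaterial, see \<open>trace_on_eq\<close>.\<close>

definition trace_on :: "'a::euclidean_space set \<Rightarrow> ('a \<Rightarrow> 'a \<Rightarrow> real) \<Rightarrow> real"
  where "trace_on W A = (\<Sum>e\<in>(SOME B. orthonormal_basis_of W B). A e e)"

lemma orthonormal_basis_of_finite:
  fixes B :: "'a::euclidean_space set"
  assumes "orthonormal_basis_of W B"
  shows "finite B"
  using assms pairwise_orthogonal_imp_finite unfolding orthonormal_basis_of_def by blast

lemma orthonormal_basis_of_exists:
  fixes W :: "'a::euclidean_space set"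
  assumes "subspace W"
  shows "\<exists>B. orthonormal_basis_of W B"
  using orthonormal_basis_subspace[OF assms] unfolding orthonormal_basis_of_def by metis

lemma orthonormal_basis_of_expand:
  fixes W :: "'a::euclidean_space set"
  assumes B: "orthonormal_basis_of W B" and x: "x \<in> W"
  shows "x = (\<Sum>e\<in>B. (x \<bullet> e) *\<^sub>R e)"
proof -
  have po: "pairwise orthogonal B" and n1: "\<And>e. e \<in> B \<Longrightarrow> norm e = 1" and sp: "span B = W"
    using B by (auto simp: orthonormal_basis_of_def)
  have fin: "finite B" by (rule orthonormal_basis_of_finite[OF B])
  obtain c where c: "x = (\<Sum>e\<in>B. c e *\<^sub>R e)"
    using x sp span_finite[OF fin] by auto
  have "x \<bullet> f = c f" if f: "f \<in> B" for f
  proof -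
    have "x \<bullet> f = (\<Sum>e\<in>B. c e * (e \<bullet> f))"
      by (simp add: c inner_sum_left)
    also have "\<dots> = (\<Sum>e\<in>B. if e = f then c f else 0)"
      using po f n1[OF f]
      by (intro sum.cong) (auto simp: pairwise_def orthogonal_def norm_eq_1)
    finally show ?thesis using fin f by simp
  qed
  then show ?thesis using c by simp
qed

lemma trace_on_eq:
  fixes A :: "'a::euclidean_space \<Rightarrow> 'a \<Rightarrow> real"
  assumes A: "bilinear A" and B: "orthonormal_basis_of W B"
  shows "trace_on W A = (\<Sum>e\<in>B. A e e)"
proof -
  have key: "(\<Sum>e\<in>C. A e e) = (\<Sum>f\<in>D. \<Sum>e\<in>C. (e \<bullet> f) * A e f)"
    if C: "orthonormal_basis_of W C" and D: "orthonormal_basis_of W D" for C D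
  proof -
    have "A e e = (\<Sum>f\<in>D. (e \<bullet> f) * A e f)" if e: "e \<in> C" for e
    proof -
      have "e \<in> W" using C e by (auto simp: orthonormal_basis_of_def span_base)
      then have "A e e = A e (\<Sum>f\<in>D. (e \<bullet> f) *\<^sub>R f)"
        by (rule arg_cong[OF orthonormal_basis_of_expand[OF D], of e "A e"])
      also have "\<dots> = (\<Sum>f\<in>D. A e ((e \<bullet> f) *\<^sub>R f))"
        by (rule linear_sum) (use A in \<open>simp add: bilinear_def\<close>)
      also have "\<dots> = (\<Sum>f\<in>D. (e \<bullet> f) * A e f)"
        by (rule sum.cong[OF refl]) (use bilinear_rmul[OF A] in simp)
      finally show ?thesis .
    qed
    then have "(\<Sum>e\<in>C. A e e) = (\<Sum>e\<in>C. \<Sum>f\<in>D. (e \<bullet> f) * A e f)" by simp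
    also have "\<dots> = (\<Sum>f\<in>D. \<Sum>e\<in>C. (e \<bullet> f) * A e f)" by (rule sum.swap)
    finally show ?thesis .
  qed
  have key2: "(\<Sum>f\<in>D. A f f) = (\<Sum>f\<in>D. \<Sum>e\<in>C. (e \<bullet> f) * A e f)"
    if C: "orthonormal_basis_of W C" and D: "orthonormal_basis_of W D" for C D
  proof (rule sum.cong[OF refl])
    fix f assume f: "f \<in> D"
    have "f \<in> W" using D f by (auto simp: orthonormal_basis_of_def span_base)
    then have "A f f = A (\<Sum>e\<in>C. (f \<bullet> e) *\<^sub>R e) f"
      by (rule arg_cong[OF orthonormal_basis_of_expand[OF C], of f "\<lambda>v. A v f"])
    also have "\<dots> = (\<Sum>e\<in>C. (f \<bullet> e) * A e f)"
    proof -
      have lin: "linear (\<lambda>v. A v f)" using A by (simp add: bilinear_def)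
      have "A (\<Sum>e\<in>C. (f \<bullet> e) *\<^sub>R e) f = (\<Sum>e\<in>C. A ((f \<bullet> e) *\<^sub>R e) f)"
        by (rule linear_sum[OF lin])
      also have "\<dots> = (\<Sum>e\<in>C. (f \<bullet> e) * A e f)"
        by (rule sum.cong[OF refl]) (use linear_cmul[OF lin] in simp)
      finally show ?thesis .
    qed
    finally show "A f f = (\<Sum>e\<in>C. (e \<bullet> f) * A e f)"
      by (simp add: inner_commute)
  qed
  have some: "orthonormal_basis_of W (SOME B. orthonormal_basis_of W B)"
    using B by (rule someI)
  show ?thesis
    unfolding trace_on_def by (rule trans[OF key[OF some B] key2[OF some B, symmetric]])
qed

definition P_LAG :: "(complex^'n \<Rightarrow> complex^'n \<Rightarrow> real) set"
  where "P_LAG = {A \<in> Sym2. \<forall>W\<in>LAG. trace_on W A \<ge> 0}"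

text \<open>
  \<open>Ck_on k f S\<close> is intended for open \<open>S\<close>. As the domain is finite-dimensional, asking for
  \<open>C\<^sup>k\<close> directional derivatives is the same as asking for a \<open>C\<^sup>k\<close> total derivative.
\<close>

fun Ck_on :: "nat \<Rightarrow> ('a::euclidean_space \<Rightarrow> real) \<Rightarrow> 'a set \<Rightarrow> bool"
  where
    "Ck_on 0 f S \<longleftrightarrow> continuous_on S f"
  | "Ck_on (Suc k) f S \<longleftrightarrow>
      (\<forall>x\<in>S. f differentiable (at x)) \<and>
      (\<forall>v. Ck_on k (\<lambda>x. frechet_derivative f (at x) v) S)"

definition smooth_on :: "('a::euclidean_space \<Rightarrow> real) \<Rightarrow> 'a set \<Rightarrow> bool"
  where "smooth_on f S \<longleftrightarrow> (\<forall>k. Ck_on k f S)"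

definition second_derivative :: "('a::euclidean_space \<Rightarrow> real) \<Rightarrow> 'a \<Rightarrow> 'a \<Rightarrow> 'a \<Rightarrow> real"
  where "second_derivative f x v w =
    frechet_derivative (\<lambda>y. frechet_derivative f (at y) v) (at x) w"

definition upper_semicontinuous_on :: "'a::topological_space set \<Rightarrow> ('a \<Rightarrow> ereal) \<Rightarrow> bool"
  where "upper_semicontinuous_on S u \<longleftrightarrow>
    (\<forall>x\<in>S. \<forall>a. u x < a \<longrightarrow> eventually (\<lambda>y. u y < a) (at x within S))"

text \<open>Only the values on \<open>\<Omega>\<close> matter; test functions live on open neighbourhoods inside \<open>\<Omega>\<close>.\<close>

definition lagrangian_psh :: "(complex^'n) set \<Rightarrow> (complex^'n \<Rightarrow> ereal) \<Rightarrow> bool"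
  where "lagrangian_psh \<Omega> u \<longleftrightarrow>
    (\<forall>x\<in>\<Omega>. u x < \<infinity>) \<and>
    upper_semicontinuous_on \<Omega> u \<and>
    (\<forall>x\<in>\<Omega>. \<forall>U \<phi>. open U \<and> x \<in> U \<and> U \<subseteq> \<Omega> \<and> smooth_on \<phi> U \<and>
        (\<forall>y\<in>U. u y \<le> ereal (\<phi> y)) \<and> u x = ereal (\<phi> x)
      \<longrightarrow> second_derivative \<phi> x \<in> P_LAG)"

definition lagrangian_pluriharmonic :: "(complex^'n) set \<Rightarrow> (complex^'n \<Rightarrow> real) \<Rightarrow> bool"
  where "lagrangian_pluriharmonic \<Omega> h \<longleftrightarrow>
    continuous_on \<Omega> h \<and>
    lagrangian_psh \<Omega> (\<lambda>z. ereal (h z)) \<and>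
    lagrangian_psh \<Omega> (\<lambda>z. ereal (- h z))"

end

theory Submission
  imports Defs
begin

text \<open>
  Adding the trace conditions for a Lagrangian plane and its orthogonal complement shows that a
  pluriharmonic \<open>h\<close> is harmonic in the viscosity sense. On a sphere \<open>h\<close> is a uniform limit of
  polynomials, every polynomial agrees on a sphere with a harmonic polynomial, and the comparison
  principle turns this into uniform approximation of \<open>h\<close> by harmonic polynomials \<open>v\<^sub>k\<close> on a ball.
  Interior gradient estimates make all derivatives of \<open>v\<^sub>k\<close> converge on smaller balls, so \<open>h\<close> has
  a second order Taylor expansion at every point, and its quadratic part \<open>Q\<close> can be tested from
  above and from below: \<open>Q\<close> and \<open>-Q\<close> lie in \<open>P_LAG\<close>. Replacing one vector \<open>e\<close> of a Lagrangian
  orthonormal basis by \<open>J e\<close> shows \<open>Q (J v) (J w) = Q v w\<close>. A symmetric trilinear form that is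
  \<open>J\<close>-invariant in two of its arguments vanishes, so the third derivatives of \<open>v\<^sub>k\<close> tend to \<open>0\<close>
  and \<open>h\<close> is locally a traceless hermitian quadratic polynomial; by connectedness it is one globally.
  Conversely, a traceless hermitian form has trace \<open>0\<close> on every Lagrangian plane, and the Hessian
  of a test function touching from above dominates that of the polynomial.
\<close>

section \<open>Directional derivatives and the Laplacian of polynomial functions\<close>

text \<open>The definition tests a merely continuous \<open>h\<close> by smooth functions touching
  from one side, so no derivative of \<open>h\<close> is available at the outset and differentiation
  is carried out on polynomials. In their algebra partial derivatives commute by induction on the
  generators, the Dirichlet problem is pure algebra, and a maximum argument takes the place of
  integral representations. All interior bounds depend on a harmonic polynomial only through its
  supremum on a ball, which is why they survive the limit. The third derivatives vanish by a sign:
  symmetry and T(u,v,w) = T(u,Jv,Jw) give T(y,y,y) = T(y,Jy,Jy) = T(Jy,y,Jy) = T(Jy,Jy,JJy) =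
  -T(y,Jy,Jy). The obstacle is that the Hessians of the approximants \<open>v k\<close> are
  J-invariant only in the limit. Therefore the defect of invariance is treated as a harmonic
  polynomial in its own right: it tends to 0 uniformly, hence so do its derivatives by the gradient
  estimate.\<close>

abbreviation rpoly :: "('a::real_normed_vector \<Rightarrow> real) \<Rightarrow> bool"
  where "rpoly \<equiv> real_polynomial_function"

lemmas rpoly_linear = real_polynomial_function.intros(1)
  and rpoly_const = real_polynomial_function.intros(2)
  and rpoly_add = real_polynomial_function.intros(3)
  and rpoly_mult = real_polynomial_function.intros(4)

text \<open>The direction comes first, so that \<open>dir_deriv e\<close> is an operator on
  functions that can be iterated; Hessian and Laplacian are compositions of such operators.\<close>

definition dir_deriv :: "'a \<Rightarrow> ('a::real_normed_vector \<Rightarrow> real) \<Rightarrow> 'a \<Rightarrow> real"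
  where "dir_deriv e p x = frechet_derivative p (at x) e"

lemma dir_deriv_eqI: "(p has_derivative f') (at x) \<Longrightarrow> dir_deriv e p x = f' e"
  unfolding dir_deriv_def by (metis frechet_derivative_at)

lemma has_derivative_dir_deriv:
  "p differentiable (at x) \<Longrightarrow> (p has_derivative (\<lambda>e. dir_deriv e p x)) (at x)"
  unfolding dir_deriv_def by (simp add: frechet_derivative_works[symmetric])

lemma rpoly_differentiable: "rpoly p \<Longrightarrow> p differentiable (at x)"
  by (rule differentiable_at_real_polynomial_function)

lemmas rpoly_has_derivative = has_derivative_dir_deriv[OF rpoly_differentiable]

lemma rpoly_linear_dir: "rpoly p \<Longrightarrow> linear (\<lambda>e. dir_deriv e p x)"
  using rpoly_has_derivative has_derivative_linear by blast

lemma dir_deriv_bounded_linear: "bounded_linear f \<Longrightarrow> dir_deriv e f = (\<lambda>x. f e)"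
  by (rule ext, rule dir_deriv_eqI) (rule bounded_linear_imp_has_derivative)

lemma dir_deriv_const [simp]: "dir_deriv e (\<lambda>x. c) = (\<lambda>x. 0)"
  by (rule ext, rule dir_deriv_eqI) (rule has_derivative_const)

lemma dir_deriv_add:
  "rpoly p \<Longrightarrow> rpoly q \<Longrightarrow> dir_deriv e (\<lambda>x. p x + q x) = (\<lambda>x. dir_deriv e p x + dir_deriv e q x)"
  by (rule ext, rule dir_deriv_eqI) (intro has_derivative_add rpoly_has_derivative)

lemma dir_deriv_diff:
  "rpoly p \<Longrightarrow> rpoly q \<Longrightarrow> dir_deriv e (\<lambda>x. p x - q x) = (\<lambda>x. dir_deriv e p x - dir_deriv e q x)"
  by (rule ext, rule dir_deriv_eqI) (intro has_derivative_diff rpoly_has_derivative)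

lemma dir_deriv_mult:
  "rpoly p \<Longrightarrow> rpoly q \<Longrightarrow>
    dir_deriv e (\<lambda>x. p x * q x) = (\<lambda>x. p x * dir_deriv e q x + dir_deriv e p x * q x)"
  by (rule ext, rule dir_deriv_eqI) (intro has_derivative_mult rpoly_has_derivative)

lemma dir_deriv_cmult:
  "rpoly p \<Longrightarrow> dir_deriv e (\<lambda>x. c * p x) = (\<lambda>x. c * dir_deriv e p x)"
  by (simp add: dir_deriv_mult rpoly_const)

lemma rpoly_dir_deriv [intro]: "rpoly p \<Longrightarrow> rpoly (dir_deriv e p)"
  by (induction p rule: real_polynomial_function.induct)
     (auto simp: dir_deriv_bounded_linear dir_deriv_add dir_deriv_mult)

text \<open>By the Leibniz rule both orders expand to the same four terms on a product, so induction
  on the generators gives the symmetry without any limit argument.\<close>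

lemma dir_deriv_commute:
  "rpoly p \<Longrightarrow> dir_deriv e (dir_deriv f p) = dir_deriv f (dir_deriv e p)"
proof (induction p rule: real_polynomial_function.induct)
  case (mult p q)
  then show ?case
    by (simp add: dir_deriv_mult dir_deriv_add rpoly_dir_deriv rpoly_mult
        algebra_simps)
qed (simp_all add: dir_deriv_bounded_linear dir_deriv_add rpoly_dir_deriv)

lemma dir_deriv_scale_dir:
  assumes "rpoly p"
  shows "dir_deriv (c *\<^sub>R e) p = (\<lambda>x. c * dir_deriv e p x)"
proof
  fix x
  show "dir_deriv (c *\<^sub>R e) p x = c * dir_deriv e p x"
    using linear_scale[OF rpoly_linear_dir[OF assms, of x], of c e] unfolding real_scaleR_def .
qed

lemma dir_deriv_neg_dir:
  "rpoly p \<Longrightarrow> dir_deriv (- e) p = (\<lambda>x. - dir_deriv e p x)"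
  using dir_deriv_scale_dir[of p "-1" e] unfolding scaleR_minus1_left by simp

lemma dir_deriv_basis:
  fixes p :: "'a::euclidean_space \<Rightarrow> real"
  assumes "rpoly p"
  shows "dir_deriv e p x = (\<Sum>b\<in>Basis. (e \<bullet> b) * dir_deriv b p x)"
proof -
  have "dir_deriv e p x = dir_deriv (\<Sum>b\<in>Basis. (e \<bullet> b) *\<^sub>R b) p x"
    by (simp add: euclidean_representation)
  also have "\<dots> = (\<Sum>b\<in>Basis. (e \<bullet> b) * dir_deriv b p x)"
    using linear_sum[OF rpoly_linear_dir[OF assms, of x], of "\<lambda>b. (e \<bullet> b) *\<^sub>R b" Basis]
    by (simp only: dir_deriv_scale_dir[OF assms])
  finally show ?thesis .
qed

lemma rpoly_affine:
  fixes p :: "'a::euclidean_space \<Rightarrow> real" and L :: "'b::euclidean_space \<Rightarrow> 'a"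
  assumes "rpoly p" "linear L"
  shows "rpoly (\<lambda>x. p (L x + c))"
proof -
  have "polynomial_function (\<lambda>x. L x + c)"
    using polynomial_function_add[OF polynomial_function_bounded_linear[OF
        linear_conv_bounded_linear[THEN iffD1, OF assms(2)]] polynomial_function_const[of c]] .
  from real_polynomial_function_compose[OF this assms(1)] show ?thesis
    by (simp add: o_def)
qed

lemma dir_deriv_affine:
  fixes p :: "'a::euclidean_space \<Rightarrow> real" and L :: "'b::euclidean_space \<Rightarrow> 'a"
  assumes "rpoly p" "linear L"
  shows "dir_deriv e (\<lambda>x. p (L x + c)) = (\<lambda>x. dir_deriv (L e) p (L x + c))"
proof (rule ext, rule dir_deriv_eqI)
  fix x
  have "((\<lambda>x. L x + c) has_derivative (\<lambda>e. L e)) (at x)"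
    using has_derivative_add[OF linear_imp_has_derivative[OF assms(2)] has_derivative_const[of c]]
    by simp
  from has_derivative_compose[OF this rpoly_has_derivative[OF assms(1)]]
  show "((\<lambda>x. p (L x + c)) has_derivative (\<lambda>e. dir_deriv (L e) p (L x + c))) (at x)" .
qed

lemma rpoly_continuous_on: "rpoly p \<Longrightarrow> continuous_on S p"
  by (simp add: continuous_on_polymonial_function real_polynomial_function_eq)

lemma rpoly_smooth_on:
  fixes p :: "'a::euclidean_space \<Rightarrow> real"
  assumes "rpoly p"
  shows "smooth_on p S"
proof -
  have "Ck_on k p S" for k
    using assms
  proof (induction k arbitrary: p)
    case (Suc k)
    then show ?case
      using Suc.IH[OF rpoly_dir_deriv[OF Suc.prems]]
      by (simp add: rpoly_differentiable dir_deriv_def[abs_def])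
  qed (simp add: rpoly_continuous_on)
  then show ?thesis by (simp add: smooth_on_def)
qed

lemma second_derivative_eq: "second_derivative p x v w = dir_deriv w (dir_deriv v p) x"
  by (simp add: second_derivative_def dir_deriv_def[abs_def])

lemma DERIV_along_line:
  assumes "(f has_derivative (\<lambda>e. dir_deriv e f (x + t *\<^sub>R v))) (at (x + t *\<^sub>R v))"
  shows "((\<lambda>t. f (x + t *\<^sub>R v)) has_real_derivative dir_deriv v f (x + t *\<^sub>R v)) (at t)"
proof -
  have "((\<lambda>t. x + t *\<^sub>R v) has_derivative (\<lambda>s. s *\<^sub>R v)) (at t)"
    by (auto intro!: derivative_eq_intros)
  from has_derivative_compose[OF this assms]
  have "((\<lambda>t. f (x + t *\<^sub>R v)) has_derivative (\<lambda>s. dir_deriv (s *\<^sub>R v) f (x + t *\<^sub>R v))) (at t)" .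
  moreover have "dir_deriv (s *\<^sub>R v) f (x + t *\<^sub>R v) = dir_deriv v f (x + t *\<^sub>R v) * s" for s
    using linear_scale[OF has_derivative_linear[OF assms], of s v] by simp
  ultimately show ?thesis
    by (simp add: has_field_derivative_def)
qed

lemmas rpoly_DERIV_along_line = DERIV_along_line[OF rpoly_has_derivative]

text \<open>A negative \<open>c\<close> together with g'(0) = 0 makes \<open>g'\<close> negative
  just to the right of 0, and the mean value theorem pushes \<open>g\<close> below its minimum. The
  derivative \<open>g'\<close> is a parameter so that the test fits restrictions to lines, for
  polynomials and for smooth test functions alike.\<close>

lemma second_derivative_test:
  fixes g :: "real \<Rightarrow> real"
  assumes d: "d > 0" and min: "\<And>t. \<bar>t\<bar> < d \<Longrightarrow> g 0 \<le> g t"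
    and g': "\<And>t. \<bar>t\<bar> < d \<Longrightarrow> (g has_real_derivative g' t) (at t)"
    and g'': "(g' has_real_derivative c) (at 0)"
  shows "c \<ge> 0"
proof (rule ccontr)
  assume "\<not> c \<ge> 0"
  then obtain s where s: "s > 0" "\<And>h. 0 < h \<Longrightarrow> h < s \<Longrightarrow> g' h < g' 0"
    using has_real_derivative_neg_dec_right[OF g''] by auto
  have g0: "g' 0 = 0"
    by (rule DERIV_local_min[OF g'[of 0], of d]) (use d min in auto)
  define t where "t = min (s/2) (d/2)"
  have t: "0 < t" "t < s" "t < d" using s(1) d by (auto simp: t_def min_def)
  obtain z where z: "0 < z" "z < t" "g t - g 0 = (t - 0) * g' z"
    using MVT2[OF t(1), of g g'] g' t by auto
  have "g' z < 0" using s(2)[of z] z t g0 by auto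
  then have "g t < g 0" using z t by (metis diff_gt_0_iff_gt diff_zero less_iff_diff_less_0 mult_pos_neg)
  with min[of t] t show False by auto
qed

section \<open>The Laplacian and harmonic polynomials\<close>

definition laplacian :: "('a::euclidean_space \<Rightarrow> real) \<Rightarrow> 'a \<Rightarrow> real"
  where "laplacian p x = (\<Sum>b\<in>Basis. dir_deriv b (dir_deriv b p) x)"

lemma rpoly_laplacian: "rpoly p \<Longrightarrow> rpoly (laplacian p)"
  unfolding laplacian_def[abs_def] by (intro real_polynomial_function_sum rpoly_dir_deriv) auto

lemma laplacian_const [simp]: "laplacian (\<lambda>x. c) = (\<lambda>x. 0)"
  by (simp add: laplacian_def[abs_def])

lemma laplacian_bounded_linear [simp]: "bounded_linear f \<Longrightarrow> laplacian f = (\<lambda>x. 0)"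
  by (simp add: laplacian_def[abs_def] dir_deriv_bounded_linear)

lemma laplacian_add:
  "rpoly p \<Longrightarrow> rpoly q \<Longrightarrow> laplacian (\<lambda>x. p x + q x) = (\<lambda>x. laplacian p x + laplacian q x)"
  by (simp add: laplacian_def[abs_def] dir_deriv_add rpoly_dir_deriv sum.distrib)

lemma laplacian_diff:
  "rpoly p \<Longrightarrow> rpoly q \<Longrightarrow> laplacian (\<lambda>x. p x - q x) = (\<lambda>x. laplacian p x - laplacian q x)"
  by (simp add: laplacian_def[abs_def] dir_deriv_diff rpoly_dir_deriv sum_subtractf)

lemma laplacian_cmult:
  "rpoly p \<Longrightarrow> laplacian (\<lambda>x. c * p x) = (\<lambda>x. c * laplacian p x)"
  by (simp add: laplacian_def[abs_def] dir_deriv_cmult rpoly_dir_deriv sum_distrib_left)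

lemma laplacian_mult:
  assumes "rpoly p" "rpoly q"
  shows "laplacian (\<lambda>x. p x * q x) = (\<lambda>x. p x * laplacian q x +
    2 * (\<Sum>b\<in>Basis. dir_deriv b p x * dir_deriv b q x) + laplacian p x * q x)"
proof -
  have "dir_deriv b (dir_deriv b (\<lambda>x. p x * q x)) x = p x * dir_deriv b (dir_deriv b q) x +
      2 * (dir_deriv b p x * dir_deriv b q x) + dir_deriv b (dir_deriv b p) x * q x" for b x
    using assms by (simp add: dir_deriv_mult dir_deriv_add rpoly_dir_deriv rpoly_mult)
  then show ?thesis
    by (simp add: laplacian_def[abs_def] sum.distrib sum_distrib_left sum_distrib_right)
qed

lemma laplacian_dir_deriv: "rpoly p \<Longrightarrow> laplacian (dir_deriv e p) = dir_deriv e (laplacian p)"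
proof -
  assume p: "rpoly p"
  have "dir_deriv e (\<lambda>x. \<Sum>b\<in>B. dir_deriv b (dir_deriv b p) x) =
      (\<lambda>x. \<Sum>b\<in>B. dir_deriv e (dir_deriv b (dir_deriv b p)) x)" if "finite B" for B
    using that
    by (induction B rule: finite_induct)
       (simp_all add: dir_deriv_add p rpoly_dir_deriv real_polynomial_function_sum)
  from this[OF finite_Basis] show ?thesis
    by (simp add: laplacian_def[abs_def] dir_deriv_commute[of _ _ e] p rpoly_dir_deriv)
qed

definition harmonic_poly :: "('a::euclidean_space \<Rightarrow> real) \<Rightarrow> bool"
  where "harmonic_poly p \<longleftrightarrow> rpoly p \<and> laplacian p = (\<lambda>x. 0)"

lemma harmonic_poly_add:
  "harmonic_poly p \<Longrightarrow> harmonic_poly q \<Longrightarrow> harmonic_poly (\<lambda>x. p x + q x)"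
  by (auto simp: harmonic_poly_def laplacian_add)

lemma harmonic_poly_diff:
  "harmonic_poly p \<Longrightarrow> harmonic_poly q \<Longrightarrow> harmonic_poly (\<lambda>x. p x - q x)"
  by (auto simp: harmonic_poly_def laplacian_diff)

lemma harmonic_poly_const: "harmonic_poly (\<lambda>x. c)"
  by (auto simp: harmonic_poly_def)

lemma harmonic_poly_cmult: "harmonic_poly p \<Longrightarrow> harmonic_poly (\<lambda>x. c * p x)"
  by (auto simp: harmonic_poly_def laplacian_cmult)

lemma harmonic_poly_dir_deriv: "harmonic_poly p \<Longrightarrow> harmonic_poly (dir_deriv e p)"
  by (auto simp: harmonic_poly_def laplacian_dir_deriv)

section \<open>The Dirichlet problem for polynomial boundary data\<close>

inductive hom_poly :: "nat \<Rightarrow> ('a::euclidean_space \<Rightarrow> real) \<Rightarrow> bool" where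
  zero: "hom_poly m (\<lambda>x. 0)"
| const: "hom_poly 0 (\<lambda>x. c)"
| linear: "bounded_linear f \<Longrightarrow> hom_poly 1 f"
| add: "hom_poly m p \<Longrightarrow> hom_poly m q \<Longrightarrow> hom_poly m (\<lambda>x. p x + q x)"
| mult: "hom_poly m p \<Longrightarrow> hom_poly n q \<Longrightarrow> hom_poly (m + n) (\<lambda>x. p x * q x)"

lemma hom_poly_imp_rpoly: "hom_poly m p \<Longrightarrow> rpoly p"
  by (induction rule: hom_poly.induct) auto

lemma hom_poly_cmult: "hom_poly m p \<Longrightarrow> hom_poly m (\<lambda>x. c * p x)"
  using hom_poly.mult[OF hom_poly.const] by force

lemma hom_poly_sum: "(\<And>i. i \<in> I \<Longrightarrow> hom_poly m (f i)) \<Longrightarrow> hom_poly m (\<lambda>x. \<Sum>i\<in>I. f i x)"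
  by (induction I rule: infinite_finite_induct) (auto intro: hom_poly.zero hom_poly.add)

lemma euler_identity: "hom_poly m p \<Longrightarrow> dir_deriv x p x = real m * p x"
proof (induction rule: hom_poly.induct)
  case (mult m p n q)
  then show ?case
    by (simp add: dir_deriv_mult hom_poly_imp_rpoly algebra_simps)
qed (simp_all add: dir_deriv_bounded_linear dir_deriv_add hom_poly_imp_rpoly algebra_simps)

text \<open>Degrees are natural numbers, so degree 0 and successor degrees are treated together: in
  the product rule a factor of degree 0 contributes a vanishing term, whose degree could not be
  written as a predecessor.\<close>

lemma hom_poly_dir_deriv_cases:
  "hom_poly m p \<Longrightarrow> (m = 0 \<longrightarrow> dir_deriv e p = (\<lambda>x. 0)) \<and> (\<forall>k. m = Suc k \<longrightarrow> hom_poly k (dir_deriv e p))"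
proof (induction rule: hom_poly.induct)
  case (linear f)
  then show ?case by (simp add: dir_deriv_bounded_linear hom_poly.const)
next
  case (mult m p n q)
  have eq: "dir_deriv e (\<lambda>x. p x * q x) = (\<lambda>x. p x * dir_deriv e q x + dir_deriv e p x * q x)"
    using mult by (intro dir_deriv_mult hom_poly_imp_rpoly)
  show ?case
  proof (cases m)
    case 0
    then have [simp]: "dir_deriv e p = (\<lambda>x. 0)" using mult.IH by simp
    show ?thesis
    proof (cases n)
      case (Suc n')
      then have "hom_poly n' (dir_deriv e q)" using mult.IH by blast
      from hom_poly.mult[OF mult.hyps(1) this] show ?thesis using 0 Suc by (simp add: eq)
    qed (use mult.IH 0 in \<open>simp add: eq\<close>)
  next
    case (Suc m')
    then have "hom_poly m' (dir_deriv e p)" using mult.IH by blast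
    from hom_poly.mult[OF this mult.hyps(2)]
    have 1: "hom_poly (m' + n) (\<lambda>x. dir_deriv e p x * q x)" .
    have 2: "hom_poly (m' + n) (\<lambda>x. p x * dir_deriv e q x)"
    proof (cases n)
      case (Suc n')
      then have "hom_poly n' (dir_deriv e q)" using mult.IH by blast
      from hom_poly.mult[OF mult.hyps(1) this] show ?thesis
        using Suc \<open>m = Suc m'\<close> by simp
    qed (use mult.IH in \<open>simp add: hom_poly.zero\<close>)
    show ?thesis using hom_poly.add[OF 2 1] Suc by (simp add: eq)
  qed
next
  case (add m p q)
  then show ?case
    by (auto simp: dir_deriv_add hom_poly_imp_rpoly intro: hom_poly.add)
qed (auto intro: hom_poly.zero)

lemma hom_poly_dir_deriv: "hom_poly (Suc m) p \<Longrightarrow> hom_poly m (dir_deriv e p)"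
  using hom_poly_dir_deriv_cases by blast

lemma hom_poly_0_dir_deriv: "hom_poly 0 p \<Longrightarrow> dir_deriv e p = (\<lambda>x. 0)"
  using hom_poly_dir_deriv_cases by blast

lemma hom_poly_laplacian: "hom_poly (Suc (Suc m)) p \<Longrightarrow> hom_poly m (laplacian p)"
  unfolding laplacian_def[abs_def] by (intro hom_poly_sum hom_poly_dir_deriv)

lemma hom_poly_laplacian_0:
  assumes "hom_poly m p" "m < 2"
  shows "laplacian p = (\<lambda>x. 0)"
proof -
  have "dir_deriv b (dir_deriv b p) = (\<lambda>x. 0)" for b
  proof (cases m)
    case 0
    then show ?thesis using hom_poly_0_dir_deriv[of p b] assms by simp
  next
    case (Suc k)
    then show ?thesis using hom_poly_0_dir_deriv[of "dir_deriv b p" b] hom_poly_dir_deriv[of 0 p b] assms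
      by (auto simp: less_Suc_eq)
  qed
  then show ?thesis by (simp add: laplacian_def[abs_def])
qed

lemma hom_poly_laplacian_funpow:
  "hom_poly m p \<Longrightarrow> 2 * k \<le> m \<Longrightarrow> hom_poly (m - 2 * k) ((laplacian ^^ k) p)"
proof (induction k)
  case (Suc k)
  have "m - 2 * k = Suc (Suc (m - 2 * Suc k))" using Suc.prems by simp
  with Suc have "hom_poly (Suc (Suc (m - 2 * Suc k))) ((laplacian ^^ k) p)" by simp
  from hom_poly_laplacian[OF this] show ?case by simp
qed simp

lemma hom_poly_laplacian_funpow_0:
  assumes "hom_poly m p" "m < 2 * k"
  shows "(laplacian ^^ k) p = (\<lambda>x. 0)"
proof -
  have z: "(laplacian ^^ j) (\<lambda>x. 0) = (\<lambda>x::'a. 0)" for j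
    by (induction j) auto
  \<comment> \<open>After \<open>m div 2\<close> Laplacians the degree is 0 or 1, and one more
    Laplacian gives zero.\<close>
  define j where "j = m div 2"
  have j: "2 * j \<le> m" "m - 2 * j < 2" by (auto simp: j_def)
  have "laplacian ((laplacian ^^ j) p) = (\<lambda>x. 0)"
    using hom_poly_laplacian_funpow[OF assms(1) j(1)] j(2) hom_poly_laplacian_0 by blast
  moreover obtain i where "k = i + Suc j"
    using assms(2) by (metis j_def add.commute less_mult_imp_div_less mult.commute less_iff_Suc_add add_Suc_right)
  ultimately show ?thesis using fun_cong[OF funpow_add[of i "Suc j" laplacian], of p] by (simp add: z del: add_Suc_right)
qed

section \<open>Laplacians of powers of |x|^2 times a homogeneous polynomial\<close>

lemma rpoly_norm_sq: "rpoly (\<lambda>x::'a::euclidean_space. x \<bullet> x)"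
proof -
  have "rpoly (\<lambda>x::'a. \<Sum>b\<in>Basis. (x \<bullet> b) * (x \<bullet> b))"
    by (intro real_polynomial_function_sum rpoly_mult rpoly_linear bounded_linear_inner_left) auto
  then show ?thesis by (simp add: euclidean_inner[symmetric])
qed

lemma hom_poly_norm_sq: "hom_poly 2 (\<lambda>x::'a::euclidean_space. x \<bullet> x)"
proof -
  have "hom_poly (1+1) (\<lambda>x::'a. \<Sum>b\<in>Basis. (x \<bullet> b) * (x \<bullet> b))"
    by (intro hom_poly_sum hom_poly.mult hom_poly.linear bounded_linear_inner_left)
  then show ?thesis by (simp add: euclidean_inner[symmetric] one_add_one[symmetric] del: one_add_one)
qed

lemma dir_deriv_norm_sq: "dir_deriv e (\<lambda>x::'a::euclidean_space. x \<bullet> x) = (\<lambda>x. 2 * (x \<bullet> e))"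
proof (rule ext, rule dir_deriv_eqI)
  fix x :: 'a
  have "((\<lambda>x. x \<bullet> x) has_derivative (\<lambda>e. x \<bullet> e + e \<bullet> x)) (at x)"
    by (intro has_derivative_inner has_derivative_ident)
  then show "((\<lambda>x. x \<bullet> x) has_derivative (\<lambda>e. 2 * (x \<bullet> e))) (at x)"
    by (simp add: inner_commute)
qed

lemma laplacian_norm_sq:
  "laplacian (\<lambda>x::'a::euclidean_space. x \<bullet> x) = (\<lambda>x. 2 * real DIM('a))"
proof -
  have "dir_deriv b (\<lambda>x::'a. 2 * (x \<bullet> b)) = (\<lambda>x. 2 * (b \<bullet> b))" for b
    using dir_deriv_cmult[OF rpoly_linear[OF bounded_linear_inner_left]]
      dir_deriv_bounded_linear[OF bounded_linear_inner_left] by metis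
  then show ?thesis
    by (simp add: laplacian_def[abs_def] dir_deriv_norm_sq mult.commute)
qed

text \<open>The cross term of the product rule is four times the derivative of \<open>g\<close>
  along x, which Euler's identity turns into 4 m g; the other constant is the Laplacian of
  |x|^2.\<close>

lemma laplacian_norm_sq_mult:
  fixes g :: "'a::euclidean_space \<Rightarrow> real"
  assumes "hom_poly m g"
  shows "laplacian (\<lambda>x. (x \<bullet> x) * g x) =
    (\<lambda>x. (x \<bullet> x) * laplacian g x + (4 * real m + 2 * real DIM('a)) * g x)"
proof
  fix x :: 'a
  have g: "rpoly g" using assms by (rule hom_poly_imp_rpoly)
  have "(\<Sum>b\<in>Basis. dir_deriv b (\<lambda>x. x \<bullet> x) x * dir_deriv b g x) = 2 * dir_deriv x g x"
    unfolding dir_deriv_basis[OF g, of x] by (simp add: dir_deriv_norm_sq sum_distrib_left mult.assoc)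
  then show "laplacian (\<lambda>x. (x \<bullet> x) * g x) x =
     (x \<bullet> x) * laplacian g x + (4 * real m + 2 * real DIM('a)) * g x"
    unfolding laplacian_mult[OF rpoly_norm_sq g] laplacian_norm_sq euler_identity[OF assms]
    by (simp add: algebra_simps)
qed

lemma hom_poly_norm_sq_power_mult:
  "hom_poly d f \<Longrightarrow> hom_poly (2 * k + d) (\<lambda>x::'a::euclidean_space. (x \<bullet> x) ^ k * f x)"
proof (induction k)
  case (Suc k)
  from hom_poly.mult[OF hom_poly_norm_sq Suc.IH[OF Suc.prems]] show ?case by (simp add: mult.assoc)
qed simp

text \<open>Each further factor |x|^2 adds the positive constant of
  \<open>laplacian_norm_sq_mult\<close>, taken at the current degree. Only positivity is recorded,
  since the constant will be divided by.\<close>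

lemma laplacian_norm_sq_power_mult:
  fixes f :: "'a::euclidean_space \<Rightarrow> real"
  assumes f: "hom_poly d f" "laplacian f = (\<lambda>x. 0)"
  shows "\<exists>c>0. laplacian (\<lambda>x. (x \<bullet> x) ^ Suc k * f x) = (\<lambda>x. c * ((x \<bullet> x) ^ k * f x))"
proof (induction k)
  case 0
  have "real DIM('a) > 0" by simp
  then show ?case
    using laplacian_norm_sq_mult[OF f(1)] f(2)
    by (intro exI[of _ "4 * real d + 2 * real DIM('a)"]) (simp add: add_nonneg_pos)
next
  case (Suc k)
  then obtain c where c: "c > 0"
    "laplacian (\<lambda>x. (x \<bullet> x) ^ Suc k * f x) = (\<lambda>x. c * ((x \<bullet> x) ^ k * f x))" by blast
  show ?case
    using laplacian_norm_sq_mult[OF hom_poly_norm_sq_power_mult[OF f(1), of "Suc k"]] c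
    by (intro exI[of _ "c + (4 * real (2 * Suc k + d) + 2 * real DIM('a))"])
       (auto simp: algebra_simps intro!: add_pos_nonneg)
qed

lemma laplacian_funpow_norm_sq_power_mult:
  fixes f :: "'a::euclidean_space \<Rightarrow> real"
  assumes f: "hom_poly d f" "laplacian f = (\<lambda>x. 0)"
  shows "\<exists>c>0. (laplacian ^^ k) (\<lambda>x. (x \<bullet> x) ^ k * f x) = (\<lambda>x. c * f x)"
proof (induction k)
  case 0
  show ?case by (intro exI[of _ 1]) simp
next
  case (Suc k)
  then obtain c where c: "c > 0" "(laplacian ^^ k) (\<lambda>x. (x \<bullet> x) ^ k * f x) = (\<lambda>x. c * f x)"
    by blast
  obtain c' where c': "c' > 0"
    "laplacian (\<lambda>x. (x \<bullet> x) ^ Suc k * f x) = (\<lambda>x. c' * ((x \<bullet> x) ^ k * f x))"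
    using laplacian_norm_sq_power_mult[OF f] by blast
  have lin: "(laplacian ^^ j) (\<lambda>x. c' * p x) = (\<lambda>x. c' * (laplacian ^^ j) p x) \<and> rpoly ((laplacian ^^ j) p)"
    if "rpoly p" for j p using that
    by (induction j) (auto simp: laplacian_cmult rpoly_laplacian)
  have "(laplacian ^^ Suc k) (\<lambda>x. (x \<bullet> x) ^ Suc k * f x)
      = (laplacian ^^ k) (\<lambda>x. c' * ((x \<bullet> x) ^ k * f x))"
    by (simp only: funpow_Suc_right o_apply c'(2))
  also have "\<dots> = (\<lambda>x. c' * (c * f x))"
    using lin[OF hom_poly_imp_rpoly[OF hom_poly_norm_sq_power_mult[OF f(1)]]] c(2) by simp
  finally show ?case using c(1) c'(1) by (intro exI[of _ "c' * c"]) (simp add: mult.assoc)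
qed

lemma laplacian_funpow_linear:
  assumes "rpoly p" "rpoly q"
  shows "(laplacian ^^ k) (\<lambda>x. p x - c * q x) = (\<lambda>x. (laplacian ^^ k) p x - c * (laplacian ^^ k) q x)
    \<and> rpoly ((laplacian ^^ k) p) \<and> rpoly ((laplacian ^^ k) q)"
  using assms
  by (induction k)
     (auto simp: laplacian_diff laplacian_cmult rpoly_laplacian rpoly_mult rpoly_const)

text \<open>If \<open>f = \<Delta>\<^sup>k g\<close> is harmonic and homogeneous, then \<open>\<Delta>\<^sup>k (|x|\<^sup>2\<^sup>k f)\<close> is a nonzero multiple
  of \<open>f\<close>; on the unit sphere \<open>|x|\<^sup>2\<^sup>k f\<close> is just \<open>f\<close>, so subtracting a multiple of it
  from \<open>g\<close> lowers \<open>k\<close>.\<close>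

lemma hom_poly_harmonic_on_sphere:
  fixes g :: "'a::euclidean_space \<Rightarrow> real"
  assumes "hom_poly m g" "(laplacian ^^ k) g = (\<lambda>x. 0)"
  shows "\<exists>v. harmonic_poly v \<and> (\<forall>x. norm x = 1 \<longrightarrow> v x = g x)"
  using assms
proof (induction k arbitrary: g)
  case 0
  then show ?case by (intro exI[of _ "\<lambda>x. 0"]) (auto simp: harmonic_poly_const fun_eq_iff)
next
  case (Suc k)
  show ?case
  proof (cases "2 * k \<le> m")
    case False
    then show ?thesis using Suc hom_poly_laplacian_funpow_0[of m g k] by auto
  next
    case True
    define f where "f = (laplacian ^^ k) g"
    have f: "hom_poly (m - 2 * k) f" "laplacian f = (\<lambda>x. 0)"
      using hom_poly_laplacian_funpow[OF Suc.prems(1) True] Suc.prems(2) by (auto simp: f_def)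
    then have hf: "harmonic_poly f" by (simp add: harmonic_poly_def hom_poly_imp_rpoly)
    obtain c where c: "c > 0" "(laplacian ^^ k) (\<lambda>x. (x \<bullet> x) ^ k * f x) = (\<lambda>x. c * f x)"
      using laplacian_funpow_norm_sq_power_mult[OF f] by blast
    define q where "q = (\<lambda>x. (x \<bullet> x) ^ k * f x)"
    have q: "hom_poly m q"
      using hom_poly_norm_sq_power_mult[OF f(1), of k] True by (simp add: q_def)
    let ?g' = "\<lambda>x. g x - (1/c) * q x"
    have "hom_poly m ?g'"
      using hom_poly.add[OF Suc.prems(1) hom_poly_cmult[OF q, of "-(1/c)"]] by simp
    moreover have "(laplacian ^^ k) ?g' = (\<lambda>x. 0)"
      using laplacian_funpow_linear[OF hom_poly_imp_rpoly[OF Suc.prems(1)] hom_poly_imp_rpoly[OF q], of k "1/c"]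
        c by (simp add: f_def[symmetric] q_def)
    ultimately obtain v where v: "harmonic_poly v" "\<And>x. norm x = 1 \<Longrightarrow> v x = ?g' x"
      using Suc.IH[of ?g'] by blast
    have "harmonic_poly (\<lambda>x. v x + (1/c) * f x)"
      by (intro harmonic_poly_add harmonic_poly_cmult v hf)
    moreover have "v x + (1/c) * f x = g x" if "norm x = 1" for x
      using v(2)[OF that] that by (simp add: q_def norm_eq_1)
    ultimately show ?thesis by blast
  qed
qed

text \<open>Stands for the decomposition of a polynomial into homogeneous parts. A finite sum of
  homogeneous terms in any grouping suffices, because harmonic extensions from the sphere add
  up.\<close>

inductive hom_sum :: "('a::euclidean_space \<Rightarrow> real) \<Rightarrow> bool" where
  hom: "hom_poly m p \<Longrightarrow> hom_sum p"
| add: "hom_sum p \<Longrightarrow> hom_sum q \<Longrightarrow> hom_sum (\<lambda>x. p x + q x)"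

lemma hom_sum_mult_hom: "hom_sum q \<Longrightarrow> hom_poly m p \<Longrightarrow> hom_sum (\<lambda>x. p x * q x)"
  by (induction rule: hom_sum.induct)
     (auto simp: distrib_left intro: hom_sum.add hom_sum.hom[OF hom_poly.mult])

lemma hom_sum_mult: "hom_sum p \<Longrightarrow> hom_sum q \<Longrightarrow> hom_sum (\<lambda>x. p x * q x)"
  by (induction rule: hom_sum.induct)
     (auto simp: distrib_right intro: hom_sum.add hom_sum_mult_hom)

lemma rpoly_hom_sum: "rpoly p \<Longrightarrow> hom_sum p"
  by (induction rule: real_polynomial_function.induct)
     (blast intro: hom_sum.intros hom_poly.intros hom_sum_mult)+

lemma harmonic_on_unit_sphere:
  fixes g :: "'a::euclidean_space \<Rightarrow> real"
  assumes "rpoly g"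
  shows "\<exists>v. harmonic_poly v \<and> (\<forall>x. norm x = 1 \<longrightarrow> v x = g x)"
  using rpoly_hom_sum[OF assms]
proof (induction rule: hom_sum.induct)
  case (hom m p)
  then show ?case
    \<comment> \<open>\<open>Suc m\<close> Laplacians exceed half the degree and so annihilate
      \<open>p\<close>.\<close>
    using hom_poly_harmonic_on_sphere[OF hom hom_poly_laplacian_funpow_0[OF hom, of "Suc m"]] by simp
next
  case (add p q)
  then obtain u v where "harmonic_poly u" "\<forall>x. norm x = 1 \<longrightarrow> u x = p x"
    "harmonic_poly v" "\<forall>x. norm x = 1 \<longrightarrow> v x = q x" by blast
  then show ?case
    by (intro exI[of _ "\<lambda>x. u x + v x"]) (auto intro: harmonic_poly_add)
qed

lemma harmonic_poly_affine_scale: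
  fixes p :: "'a::euclidean_space \<Rightarrow> real"
  assumes "harmonic_poly p"
  shows "harmonic_poly (\<lambda>x. p (r *\<^sub>R x + c))"
proof -
  have L: "linear (\<lambda>x::'a. r *\<^sub>R x)" by (simp add: linear_scale_self)
  have p: "rpoly p" "laplacian p = (\<lambda>x. 0)" using assms by (auto simp: harmonic_poly_def)
  have "dir_deriv b (dir_deriv b (\<lambda>x. p (r *\<^sub>R x + c))) x =
      r * (r * dir_deriv b (dir_deriv b p) (r *\<^sub>R x + c))" for b x
    using p(1) rpoly_affine[OF rpoly_dir_deriv[OF p(1)] L]
    by (simp add: dir_deriv_affine[OF _ L] rpoly_dir_deriv dir_deriv_scale_dir dir_deriv_cmult)
  then have "laplacian (\<lambda>x. p (r *\<^sub>R x + c)) = (\<lambda>x. r * (r * laplacian p (r *\<^sub>R x + c)))"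
    by (simp add: laplacian_def[abs_def] sum_distrib_left)
  then show ?thesis using p by (simp add: harmonic_poly_def rpoly_affine[OF _ L])
qed

lemma harmonic_on_sphere:
  fixes g :: "'a::euclidean_space \<Rightarrow> real"
  assumes g: "rpoly g" and R: "R > 0"
  shows "\<exists>v. harmonic_poly v \<and> (\<forall>x\<in>sphere a R. v x = g x)"
proof -
  have "linear (\<lambda>x::'a. R *\<^sub>R x)" by (simp add: linear_scale_self)
  from harmonic_on_unit_sphere[OF rpoly_affine[OF g this, of a]]
  obtain v where v: "harmonic_poly v" "\<And>x. norm x = 1 \<Longrightarrow> v x = g (R *\<^sub>R x + a)" by blast
  have "v ((1/R) *\<^sub>R x + (- (1/R) *\<^sub>R a)) = g x" if "x \<in> sphere a R" for x
  proof -
    have "(1/R) *\<^sub>R x + (- (1/R) *\<^sub>R a) = (1/R) *\<^sub>R (x - a)" by (simp add: algebra_simps)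
    moreover have "norm ((1/R) *\<^sub>R (x - a)) = 1"
      using that R by (simp add: dist_norm norm_minus_commute)
    ultimately show ?thesis using v(2) R by simp
  qed
  then show ?thesis using harmonic_poly_affine_scale[OF v(1)] by blast
qed

section \<open>Comparison principle and interior estimates\<close>

text \<open>Testing with polynomials only is the weaker condition, yet it fits the comparison
  argument, where the touching function is a harmonic polynomial plus a quadratic one.\<close>

definition visc_subharmonic :: "'a::euclidean_space set \<Rightarrow> ('a \<Rightarrow> real) \<Rightarrow> bool"
  where "visc_subharmonic S u \<longleftrightarrow>
    (\<forall>x U \<phi>. open U \<and> x \<in> U \<and> U \<subseteq> S \<and> rpoly \<phi> \<and> (\<forall>y\<in>U. u y \<le> \<phi> y) \<and> u x = \<phi> x
      \<longrightarrow> laplacian \<phi> x \<ge> 0)"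

lemma segment_in_open:
  fixes v :: "'a::real_normed_vector"
  assumes "open U" "x \<in> U"
  shows "\<exists>d>0. \<forall>t. \<bar>t\<bar> < d \<longrightarrow> x + t *\<^sub>R v \<in> U"
proof -
  obtain r where r: "r > 0" "ball x r \<subseteq> U" using assms openE by blast
  have nv: "norm v + 1 > 0" by (simp add: add_nonneg_pos)
  have "x + t *\<^sub>R v \<in> U" if "\<bar>t\<bar> < r / (norm v + 1)" for t
  proof -
    have "\<bar>t\<bar> * norm v \<le> \<bar>t\<bar> * (norm v + 1)" by (simp add: mult_left_mono)
    also have "\<dots> < r" using that nv by (simp add: pos_less_divide_eq)
    finally show ?thesis using r(2) by (auto simp: dist_norm)
  qed
  then show ?thesis using r nv by (intro exI[of _ "r / (norm v + 1)"]) simp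
qed

lemma rpoly_local_min:
  fixes p :: "'a::euclidean_space \<Rightarrow> real"
  assumes p: "rpoly p" and U: "open U" "x \<in> U" and min: "\<And>y. y \<in> U \<Longrightarrow> p x \<le> p y"
  shows "dir_deriv b (dir_deriv b p) x \<ge> 0"
proof -
  obtain d where d: "d > 0" and inU: "\<And>t. \<bar>t\<bar> < d \<Longrightarrow> x + t *\<^sub>R b \<in> U"
    using segment_in_open[OF U] by blast
  show ?thesis
  proof (rule second_derivative_test[OF d])
    show "p (x + 0 *\<^sub>R b) \<le> p (x + t *\<^sub>R b)" if "\<bar>t\<bar> < d" for t
      using min[OF inU[OF that]] by simp
    show "((\<lambda>t. p (x + t *\<^sub>R b)) has_real_derivative dir_deriv b p (x + t *\<^sub>R b)) (at t)" for t
      by (rule rpoly_DERIV_along_line[OF p])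
    show "((\<lambda>t. dir_deriv b p (x + t *\<^sub>R b)) has_real_derivative dir_deriv b (dir_deriv b p) x) (at 0)"
      using rpoly_DERIV_along_line[OF rpoly_dir_deriv[OF p], where x=x and t=0 and v=b] by simp
  qed
qed

text \<open>At a contact point \<phi> - w has a local minimum. This allows
  \<open>comparison_principle\<close> to be applied between two harmonic polynomials in the gradient
  estimate.\<close>

lemma harmonic_poly_visc_subharmonic:
  assumes "harmonic_poly w"
  shows "visc_subharmonic S w"
  unfolding visc_subharmonic_def
proof (intro allI impI, elim conjE)
  fix x U \<phi>
  assume U: "open U" "x \<in> U" and \<phi>: "rpoly \<phi>" "\<forall>y\<in>U. w y \<le> \<phi> y" "w x = \<phi> x"
  have w: "rpoly w" "laplacian w = (\<lambda>x. 0)" using assms by (auto simp: harmonic_poly_def)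
  have "dir_deriv b (dir_deriv b (\<lambda>x. \<phi> x - w x)) x \<ge> 0" for b
    by (rule rpoly_local_min[OF real_polynomial_function_diff[OF \<phi>(1) w(1)] U]) (use \<phi> in auto)
  then have "laplacian (\<lambda>x. \<phi> x - w x) x \<ge> 0" by (simp add: laplacian_def sum_nonneg)
  then show "laplacian \<phi> x \<ge> 0" by (simp add: laplacian_diff \<phi> w)
qed

text \<open>If u exceeds v somewhere, then u - v + \<epsilon> |y|^2 still has its maximum in the
  interior for small \<epsilon>. There v - \<epsilon> |y|^2 plus a constant touches u from above,
  although its Laplacian is negative.\<close>

lemma comparison_principle:
  fixes u :: "'a::euclidean_space \<Rightarrow> real"
  assumes K: "compact K" and u: "continuous_on K u" "visc_subharmonic (interior K) u"
    and v: "harmonic_poly v" and le: "\<And>x. x \<in> frontier K \<Longrightarrow> u x \<le> v x"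
    and x: "x \<in> K"
  shows "u x \<le> v x"
proof (rule ccontr)
  assume "\<not> u x \<le> v x"
  define m where "m = u x - v x"
  have m: "m > 0" using \<open>\<not> _\<close> by (simp add: m_def)
  obtain B where B: "B > 0" "\<And>y. y \<in> K \<Longrightarrow> norm y \<le> B"
    using compact_imp_bounded[OF K] bounded_pos by metis
  have BB: "y \<bullet> y \<le> B\<^sup>2" if "y \<in> K" for y
    using B(2)[OF that] by (simp add: dot_square_norm power_mono)
  \<comment> \<open>With this choice the perturbation is at most m/2 on \<open>K\<close>, too small
    to move the maximum to the frontier.\<close>
  define \<epsilon> where "\<epsilon> = m / (2 * B\<^sup>2)"
  have \<epsilon>: "\<epsilon> > 0" using m B by (simp add: \<epsilon>_def)
  have rv: "rpoly v" "laplacian v = (\<lambda>x. 0)" using v by (auto simp: harmonic_poly_def)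
  define w where "w = (\<lambda>y. u y - v y + \<epsilon> * (y \<bullet> y))"
  have "continuous_on K w"
    unfolding w_def by (intro continuous_intros u rpoly_continuous_on rv)
  then obtain z where z: "z \<in> K" "\<And>y. y \<in> K \<Longrightarrow> w y \<le> w z"
    using continuous_attains_sup[OF K] x by blast
  have "m \<le> w x" using \<epsilon> by (simp add: w_def m_def)
  then have wz: "m \<le> w z" using z(2)[OF x] by simp
  have "z \<notin> frontier K"
  proof
    assume "z \<in> frontier K"
    moreover have "\<epsilon> * (z \<bullet> z) \<le> \<epsilon> * B\<^sup>2"
      by (rule mult_left_mono[OF BB[OF z(1)]]) (use \<epsilon> in simp)
    ultimately have "w z \<le> \<epsilon> * B\<^sup>2"
      using le[of z] by (simp add: w_def)
    then show False using wz m B by (simp add: \<epsilon>_def)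
  qed
  then have zi: "z \<in> interior K" using z(1) by (simp add: frontier_def closure_subset[THEN subsetD])
  let ?\<phi> = "\<lambda>y. (v y - \<epsilon> * (y \<bullet> y)) + w z"
  have r: "rpoly (\<lambda>y::'a. \<epsilon> * (y \<bullet> y))" by (intro rpoly_mult rpoly_const rpoly_norm_sq)
  have "rpoly ?\<phi>" by (intro rpoly_add real_polynomial_function_diff rpoly_const rv r)
  moreover have "u y \<le> ?\<phi> y" if "y \<in> interior K" for y
    using z(2)[of y] that interior_subset by (force simp: w_def)
  moreover have "u z = ?\<phi> z" by (simp add: w_def)
  ultimately have "laplacian ?\<phi> z \<ge> 0"
    using u(2) zi open_interior unfolding visc_subharmonic_def by blast
  moreover have "laplacian ?\<phi> z = - (\<epsilon> * (2 * real DIM('a)))"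
    using laplacian_add[OF real_polynomial_function_diff[OF rv(1) r] rpoly_const, of "w z"]
      laplacian_diff[OF rv(1) r] laplacian_cmult[OF rpoly_norm_sq[where 'a='a], of \<epsilon>] laplacian_norm_sq[where 'a='a]
    by (simp add: rv fun_eq_iff)
  moreover have "\<epsilon> * (2 * real DIM('a)) > 0" using \<epsilon> by simp
  ultimately show False by linarith
qed

section \<open>Interior gradient estimate\<close>

text \<open>Reflection in a coordinate hyperplane sends each basis vector to itself or to its
  negative, and the sign cancels in a pure second derivative.\<close>

lemma harmonic_poly_reflect:
  fixes v :: "'a::euclidean_space \<Rightarrow> real"
  assumes v: "harmonic_poly v" and e: "e \<in> Basis"
  shows "harmonic_poly (\<lambda>y. v (y - (2 * (y \<bullet> e)) *\<^sub>R e + c))"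
proof -
  define \<rho> where "\<rho> = (\<lambda>y::'a. y - (2 * (y \<bullet> e)) *\<^sub>R e)"
  have L: "linear \<rho>"
    unfolding \<rho>_def by (rule linearI) (simp_all add: algebra_simps inner_add_left)
  have p: "rpoly v" "laplacian v = (\<lambda>x. 0)" using v by (auto simp: harmonic_poly_def)
  have \<rho>b: "\<rho> b = (if b = e then - e else b)" if "b \<in> Basis" for b
    using that e by (auto simp: \<rho>_def inner_Basis scaleR_2)
  have "dir_deriv b (dir_deriv b (\<lambda>y. v (\<rho> y + c))) x = dir_deriv b (dir_deriv b v) (\<rho> x + c)"
    if "b \<in> Basis" for b x
  proof -
    have "dir_deriv b (dir_deriv b (\<lambda>y. v (\<rho> y + c))) x = dir_deriv (\<rho> b) (dir_deriv (\<rho> b) v) (\<rho> x + c)"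
      by (simp add: dir_deriv_affine[OF _ L] p rpoly_dir_deriv)
    also have "\<dots> = dir_deriv b (dir_deriv b v) (\<rho> x + c)"
      using dir_deriv_cmult[OF rpoly_dir_deriv[OF p(1)], of _ "-1"]
      by (simp add: \<rho>b[OF that] dir_deriv_neg_dir p rpoly_dir_deriv real_polynomial_function_minus)
    finally show ?thesis .
  qed
  then have "laplacian (\<lambda>y. v (\<rho> y + c)) = (\<lambda>x. laplacian v (\<rho> x + c))"
    by (simp add: laplacian_def[abs_def])
  then have "harmonic_poly (\<lambda>y. v (\<rho> y + c))"
    using p by (simp add: harmonic_poly_def rpoly_affine[OF _ L])
  then show ?thesis by (simp add: \<rho>_def)
qed

text \<open>The squared coordinate has Laplacian 2, so the factor \<open>DIM('a)\<close> balances
  the Laplacian of |y|^2. The coefficient \<open>k\<close> of the linear term is free and later sets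
  the slope at the centre.\<close>

lemma harmonic_poly_barrier:
  assumes "e \<in> (Basis :: 'a::euclidean_space set)"
  shows "harmonic_poly (\<lambda>y::'a. c * (y \<bullet> y + (k * (y \<bullet> e) - real DIM('a) * ((y \<bullet> e) * (y \<bullet> e)))))"
proof -
  have l: "bounded_linear (\<lambda>y::'a. y \<bullet> e)" by (rule bounded_linear_inner_left)
  have r: "rpoly (\<lambda>y::'a. (y \<bullet> e))" by (intro rpoly_linear l)
  have r2: "rpoly (\<lambda>y::'a. (y \<bullet> e) * (y \<bullet> e))" by (intro rpoly_mult r)
  have "laplacian (\<lambda>y::'a. (y \<bullet> e) * (y \<bullet> e)) = (\<lambda>y. 2 * (e \<bullet> e))"
    unfolding laplacian_mult[OF r r] laplacian_bounded_linear[OF l] dir_deriv_bounded_linear[OF l]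
      euclidean_inner[of e e] by (simp add: inner_commute)
  moreover have "laplacian (\<lambda>y::'a. k * (y \<bullet> e)) = (\<lambda>y. 0)"
    using laplacian_cmult[OF r] laplacian_bounded_linear[OF l] by simp
  moreover have "rpoly (\<lambda>y::'a. k * (y \<bullet> e))" "rpoly (\<lambda>y::'a. real DIM('a) * ((y \<bullet> e) * (y \<bullet> e)))"
    by (intro rpoly_mult rpoly_const r)+
  ultimately have "harmonic_poly (\<lambda>y::'a. y \<bullet> y + (k * (y \<bullet> e) - real DIM('a) * ((y \<bullet> e) * (y \<bullet> e))))"
    using laplacian_norm_sq[where 'a='a] laplacian_cmult[OF r2, of "real DIM('a)"] assms
    by (simp add: harmonic_poly_def laplacian_add laplacian_diff rpoly_add rpoly_norm_sq
        real_polynomial_function_diff)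
  then show ?thesis by (rule harmonic_poly_cmult)
qed

text \<open>Compare the odd part of \<open>v\<close> under the reflection in \<open>e\<^sup>\<bottom>\<close> with a harmonic quadratic
  barrier on a half ball: both vanish at the centre, so their slopes compare as well.\<close>

lemma harmonic_gradient_basis:
  fixes v :: "'a::euclidean_space \<Rightarrow> real"
  assumes v: "harmonic_poly v" and d: "d > 0" and e: "e \<in> Basis"
    and M: "\<And>y. y \<in> cball x d \<Longrightarrow> \<bar>v y\<bar> \<le> M"
  shows "dir_deriv e v x \<le> real DIM('a) * M / d"
proof -
  define N where "N = real DIM('a)"
  have N: "N \<ge> 1" using DIM_positive[where 'a='a] by (simp add: N_def)
  have rv: "rpoly v" using v by (simp add: harmonic_poly_def)
  have M0: "M \<ge> 0" using M[of x] d by (force intro: order_trans[OF abs_ge_zero])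
  have ee: "e \<bullet> e = 1" using e by simp
  define K where "K = cball 0 d \<inter> {y. 0 \<le> y \<bullet> e}"
  define \<rho> where "\<rho> = (\<lambda>y::'a. y - (2 * (y \<bullet> e)) *\<^sub>R e)"
  define \<phi> where "\<phi> = (\<lambda>y. (1/2) * (v (y + x) - v (\<rho> y + x)))"
  \<comment> \<open>With t = y \<bullet> e the barrier is M |y|^2 / d^2 \<ge> 0 on the flat face t =
    0, and M + (M / d^2) N t (d - t) \<ge> M on the spherical part. Its slope at the centre in
    direction \<open>e\<close> is M N / d, the bound to be proved.\<close>
  define \<psi> where "\<psi> = (\<lambda>y. (M / d\<^sup>2) * (y \<bullet> y + (N * d * (y \<bullet> e) - N * ((y \<bullet> e) * (y \<bullet> e)))))"
  have h\<phi>: "harmonic_poly \<phi>"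
    unfolding \<phi>_def \<rho>_def
    using harmonic_poly_affine_scale[OF v, of 1 x] harmonic_poly_reflect[OF v e, of x]
    by (intro harmonic_poly_cmult harmonic_poly_diff) simp_all
  have h\<psi>: "harmonic_poly \<psi>"
    unfolding \<psi>_def N_def by (rule harmonic_poly_barrier[OF e])
  have \<rho>\<rho>: "norm (\<rho> y) = norm y" for y
    using ee by (simp add: \<rho>_def norm_eq algebra_simps inner_diff_left inner_diff_right inner_commute)
  have K: "compact K"
    unfolding K_def by (intro compact_Int_closed compact_cball closed_Collect_le continuous_intros)
  have bd: "\<phi> y \<le> \<psi> y" if "y \<in> frontier K" for y
  proof -
    have "ball 0 d \<inter> {y. 0 < y \<bullet> e} \<subseteq> interior K"
      by (rule interior_maximal)
         (auto simp: K_def intro!: open_Int open_Collect_less continuous_intros)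
    moreover have yK: "y \<in> K" using that K frontier_subset_closed compact_imp_closed by blast
    moreover have "y \<notin> interior K" using that by (simp add: frontier_def)
    ultimately have "y \<notin> ball 0 d \<inter> {y. 0 < y \<bullet> e}" by blast
    with \<open>y \<in> K\<close> consider "y \<bullet> e = 0" | "norm y = d" "y \<bullet> e \<ge> 0"
      unfolding K_def by (cases "y \<bullet> e = 0"; cases "norm y = d") auto
    then show ?thesis
    proof cases
      case 1
      then have "\<phi> y = 0" by (simp add: \<phi>_def \<rho>_def)
      moreover have "\<psi> y \<ge> 0" using 1 M0 by (simp add: \<psi>_def)
      ultimately show ?thesis by simp
    next
      case 2
      have "\<bar>v (y + x)\<bar> \<le> M" "\<bar>v (\<rho> y + x)\<bar> \<le> M"
        using 2 \<rho>\<rho>[of y] by (auto intro!: M simp: dist_norm)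
      then have "\<phi> y \<le> M" by (simp add: \<phi>_def)
      also have "M \<le> \<psi> y"
      proof -
        have t: "y \<bullet> e \<le> d" using norm_cauchy_schwarz[of y e] 2 e by simp
        have "0 \<le> N * ((y \<bullet> e) * (d - y \<bullet> e))" using t 2 N by simp
        then have "d\<^sup>2 \<le> y \<bullet> y + (N * d * (y \<bullet> e) - N * ((y \<bullet> e) * (y \<bullet> e)))"
          using 2(1) by (simp add: dot_square_norm algebra_simps)
        from mult_left_mono[OF this, of "M / d\<^sup>2"] show ?thesis
          using M0 d by (simp add: \<psi>_def)
      qed
      finally show ?thesis .
    qed
  qed
  have le: "\<phi> y \<le> \<psi> y" if "y \<in> K" for y
    using comparison_principle[OF K _ harmonic_poly_visc_subharmonic[OF h\<phi>] h\<psi> bd that]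
      h\<phi> rpoly_continuous_on by (auto simp: harmonic_poly_def)
  define c where "c = M / d\<^sup>2"
  \<comment> \<open>This is \<psi> - \<phi> along the ray t e, where the reflected point is -t e.
    The comparison holds for t > 0 only, so the conclusion comes from the one-sided sign of the
    derivative at 0.\<close>
  define k where "k = (\<lambda>t. c * (t\<^sup>2 + (N * d * t - N * t\<^sup>2))
      - (1/2) * (v (x + t *\<^sub>R e) - v (x + t *\<^sub>R (- e))))"
  have k: "k 0 \<le> k t" if "0 < t" "t < d" for t
  proof -
    have "t *\<^sub>R e \<in> K" using that e by (auto simp: K_def)
    from le[OF this] have "\<phi> (t *\<^sub>R e) \<le> \<psi> (t *\<^sub>R e)" .
    moreover have "\<rho> (t *\<^sub>R e) + x = x + t *\<^sub>R (- e)"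
      using ee by (simp add: \<rho>_def algebra_simps scaleR_2 flip: scaleR_scaleR)
    ultimately show ?thesis
      using ee by (simp add: k_def c_def \<phi>_def \<psi>_def power2_eq_square add.commute)
  qed
  have "(k has_real_derivative (c * (N * d) - (1/2) * (dir_deriv e v x - dir_deriv (- e) v x))) (at 0)"
    unfolding k_def
    using rpoly_DERIV_along_line[OF rv, where x=x and t=0 and v=e]
      rpoly_DERIV_along_line[OF rv, where x=x and t=0 and v="-e"]
    by (auto intro!: derivative_eq_intros simp: diff_divide_distrib)
  then have "(k has_real_derivative (M * N / d - dir_deriv e v x)) (at 0)"
    using d by (simp add: c_def dir_deriv_neg_dir[OF rv] power2_eq_square)
  then have "M * N / d - dir_deriv e v x \<ge> 0"
  proof (rule contrapos_pp)
    assume neg: "\<not> M * N / d - dir_deriv e v x \<ge> 0"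
    show "\<not> (k has_real_derivative (M * N / d - dir_deriv e v x)) (at 0)"
    proof
      assume "(k has_real_derivative (M * N / d - dir_deriv e v x)) (at 0)"
      from has_real_derivative_neg_dec_right[OF this] neg
      obtain s where s: "s > 0" "\<And>h. 0 < h \<Longrightarrow> h < s \<Longrightarrow> k h < k 0" by auto
      have "0 < min s d / 2" "min s d / 2 < s" "min s d / 2 < d" using s(1) d by auto
      then show False using s(2) k by (meson not_le)
    qed
  qed
  then show ?thesis by (simp add: N_def mult.commute)
qed

text \<open>One factor \<open>DIM('a)\<close> comes from the estimate in a basis direction, the
  other from summing over the basis. The absolute value comes from applying the one-sided bound to
  -v as well.\<close>

lemma harmonic_gradient_estimate:
  fixes v :: "'a::euclidean_space \<Rightarrow> real"
  assumes v: "harmonic_poly v" and d: "d > 0"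
    and M: "\<And>y. y \<in> cball x d \<Longrightarrow> \<bar>v y\<bar> \<le> M"
  shows "\<bar>dir_deriv e v x\<bar> \<le> (real DIM('a))\<^sup>2 / d * M * norm e"
proof -
  have rv: "rpoly v" using v by (simp add: harmonic_poly_def)
  have "dir_deriv b (\<lambda>x. (-1) * v x) x \<le> real DIM('a) * M / d" if "b \<in> Basis" for b
    by (rule harmonic_gradient_basis[OF harmonic_poly_cmult[OF v] d that]) (simp add: M)
  then have b: "\<bar>dir_deriv b v x\<bar> \<le> real DIM('a) * M / d" if "b \<in> Basis" for b
    using that harmonic_gradient_basis[OF v d that M] by (simp only: dir_deriv_cmult[OF rv]) fastforce
  have "\<bar>dir_deriv e v x\<bar> \<le> (\<Sum>b\<in>Basis. \<bar>(e \<bullet> b) * dir_deriv b v x\<bar>)"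
    unfolding dir_deriv_basis[OF rv, of e] by (rule sum_abs)
  also have "\<dots> \<le> (\<Sum>b\<in>(Basis::'a set). norm e * (real DIM('a) * M / d))"
    unfolding abs_mult by (intro sum_mono mult_mono Basis_le_norm b) auto
  finally show ?thesis by (simp add: power2_eq_square algebra_simps)
qed

lemma rpoly_taylor:
  fixes v :: "'a::euclidean_space \<Rightarrow> real"
  assumes v: "rpoly v"
  shows "\<exists>t. 0 < t \<and> t < 1 \<and> v (x + y) = v x + dir_deriv y v x + dir_deriv y (dir_deriv y v) x / 2
    + dir_deriv y (dir_deriv y (dir_deriv y v)) (x + t *\<^sub>R y) / 6"
proof -
  define D where "D = (\<lambda>m t. ((dir_deriv y) ^^ m) v (x + t *\<^sub>R y))"
  have r: "rpoly (((dir_deriv y) ^^ m) v)" for m using v by (induction m) auto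
  have "\<exists>t>0. t < 1 \<and> v (x + 1 *\<^sub>R y) = (\<Sum>m<3. D m 0 / fact m * 1 ^ m) + D 3 t / fact 3 * 1 ^ 3"
    by (rule Maclaurin[where f = "\<lambda>t. v (x + t *\<^sub>R y)"])
       (use rpoly_DERIV_along_line[OF r, where v=y] in \<open>auto simp: D_def\<close>)
  then show ?thesis
    by (simp add: D_def eval_nat_numeral fact_numeral)
qed

text \<open>The intermediate point of Taylor's formula lies within 2d of \<open>a\<close>, and
  bounding a third derivative uses the gradient estimate three times at a cost of d each; hence the
  radius 5d and the cubed factor.\<close>

lemma harmonic_second_order_bound:
  fixes v :: "'a::euclidean_space \<Rightarrow> real"
  assumes v: "harmonic_poly v" and d: "d > 0"
    and M: "\<And>y. y \<in> cball a (5 * d) \<Longrightarrow> \<bar>v y\<bar> \<le> M"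
    and x: "x \<in> cball a d" and y: "norm y \<le> d"
  shows "\<bar>v (x + y) - v x - dir_deriv y v x - dir_deriv y (dir_deriv y v) x / 2\<bar>
    \<le> ((real DIM('a))\<^sup>2 / d) ^ 3 * M * norm y ^ 3"
proof -
  have rv: "rpoly v" using v by (simp add: harmonic_poly_def)
  define C where "C = (real DIM('a))\<^sup>2 / d * norm y"
  have near: "w \<in> cball a (r + d)" if "z \<in> cball a r" "w \<in> cball z d" for z w r
    using that dist_triangle[of a w z] by simp
  have 1: "\<bar>dir_deriv y v z\<bar> \<le> C * M" if z: "z \<in> cball a (4 * d)" for z
    using harmonic_gradient_estimate[OF v d, of z M y] M near[OF z] by (simp add: C_def mult_ac)
  have 2: "\<bar>dir_deriv y (dir_deriv y v) z\<bar> \<le> C * (C * M)" if z: "z \<in> cball a (3 * d)" for z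
    using harmonic_gradient_estimate[OF harmonic_poly_dir_deriv[OF v] d, of z y "C * M" y] 1 near[OF z]
    by (simp add: C_def mult_ac)
  have 3: "\<bar>dir_deriv y (dir_deriv y (dir_deriv y v)) z\<bar> \<le> C * (C * (C * M))" if z: "z \<in> cball a (2 * d)" for z
    using harmonic_gradient_estimate[OF harmonic_poly_dir_deriv[OF harmonic_poly_dir_deriv[OF v]] d,
        of z y y "C * (C * M)" y] 2 near[OF z]
    by (simp add: C_def mult_ac)
  obtain t where t: "0 < t" "t < 1" "v (x + y) = v x + dir_deriv y v x + dir_deriv y (dir_deriv y v) x / 2
    + dir_deriv y (dir_deriv y (dir_deriv y v)) (x + t *\<^sub>R y) / 6"
    using rpoly_taylor[OF rv] by blast
  have "t * norm y \<le> d" using t y mult_mono[of t 1 "norm y" d] by simp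
  then have "x + t *\<^sub>R y \<in> cball a (2 * d)"
    using near[OF x, of "x + t *\<^sub>R y"] t by (simp add: dist_norm)
  from 3[OF this] have "\<bar>dir_deriv y (dir_deriv y (dir_deriv y v)) (x + t *\<^sub>R y)\<bar> \<le> C ^ 3 * M"
    by (simp add: power3_eq_cube mult_ac)
  with t(3) have "\<bar>v (x + y) - v x - dir_deriv y v x - dir_deriv y (dir_deriv y v) x / 2\<bar> \<le> C ^ 3 * M"
    by simp
  moreover have "C ^ 3 * M = ((real DIM('a))\<^sup>2 / d) ^ 3 * M * norm y ^ 3"
    unfolding C_def power_mult_distrib by simp
  ultimately show ?thesis by simp
qed

text \<open>The error on the sphere propagates inward because v + \<delta> and -v + \<delta> are
  harmonic and dominate h and -h there.\<close>

lemma harmonic_approx: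
  fixes h :: "'a::euclidean_space \<Rightarrow> real"
  assumes R: "R > 0" and h: "continuous_on (cball a R) h"
    and sub: "visc_subharmonic (ball a R) h" "visc_subharmonic (ball a R) (\<lambda>x. - h x)"
    and \<delta>: "\<delta> > 0"
  shows "\<exists>v. harmonic_poly v \<and> (\<forall>x\<in>cball a R. \<bar>h x - v x\<bar> \<le> \<delta>)"
proof -
  obtain g where g: "rpoly g" "\<And>x. x \<in> sphere a R \<Longrightarrow> \<bar>h x - g x\<bar> < \<delta>"
    using Stone_Weierstrass_real_polynomial_function[OF compact_sphere, of a R h \<delta>] \<delta>
      continuous_on_subset[OF h sphere_cball] by metis
  obtain v where v: "harmonic_poly v" "\<And>x. x \<in> sphere a R \<Longrightarrow> v x = g x"
    using harmonic_on_sphere[OF g(1) R] by blast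
  have fr: "frontier (cball a R) = sphere a R" "interior (cball a R) = ball a R"
    by (auto simp: interior_cball frontier_cball)
  have bd: "h x \<le> v x + \<delta>" "- h x \<le> (-1) * v x + \<delta>" if "x \<in> sphere a R" for x
    using g(2)[OF that] v(2)[OF that] by auto
  have "h x \<le> v x + \<delta>" if "x \<in> cball a R" for x
    by (rule comparison_principle[OF compact_cball h _ _ _ that])
       (use sub bd v in \<open>auto simp: fr intro!: harmonic_poly_add harmonic_poly_const\<close>)
  moreover have "- h x \<le> (-1) * v x + \<delta>" if "x \<in> cball a R" for x
    by (rule comparison_principle[OF compact_cball continuous_on_minus[OF h] _
          harmonic_poly_add[OF harmonic_poly_cmult[OF v(1)] harmonic_poly_const] _ that])
       (use sub bd in \<open>auto simp: fr\<close>)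
  ultimately have "\<bar>h x - v x\<bar> \<le> \<delta>" if "x \<in> cball a R" for x
    using that by (fastforce simp: abs_le_iff)
  then show ?thesis using v(1) by blast
qed

section \<open>Lagrangian planes and traceless hermitian forms\<close>

lemma linear_cplx_J: "linear cplx_J"
  by (rule linearI) (auto simp: cplx_J_def vec_eq_iff algebra_simps)

lemma cplx_J_cplx_J [simp]: "cplx_J (cplx_J z) = - z"
  by (simp add: cplx_J_def vec_eq_iff flip: mult.assoc)

lemma inner_cplx_J_cplx_J [simp]: "cplx_J x \<bullet> cplx_J y = x \<bullet> y"
  by (simp add: inner_vec_def cplx_J_def inner_complex_def add.commute)

lemma inner_cplx_J_left: "cplx_J x \<bullet> y = - (x \<bullet> cplx_J y)"
  using inner_cplx_J_cplx_J[of x "cplx_J y"] by simp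

lemma inner_cplx_J_self [simp]: "x \<bullet> cplx_J x = 0"
  using inner_cplx_J_left[of x x] by (simp add: inner_commute)

lemma norm_cplx_J [simp]: "norm (cplx_J x) = norm x"
  by (simp add: norm_eq)

lemma inj_cplx_J: "inj cplx_J"
  by (metis cplx_J_cplx_J injI neg_equal_iff_equal)

text \<open>These are the finite orthonormal families for the standard hermitian product, written in
  real terms. With \<open>CARD('n)\<close> elements they are the unitary bases, whose real spans are
  exactly the Lagrangian planes.\<close>

definition isotropic_set :: "(complex^'n) set \<Rightarrow> bool"
  where "isotropic_set B \<longleftrightarrow> finite B \<and> (\<forall>x\<in>B. norm x = 1) \<and>
    (\<forall>x\<in>B. \<forall>y\<in>B. x \<noteq> y \<longrightarrow> x \<bullet> y = 0) \<and> (\<forall>x\<in>B. \<forall>y\<in>B. x \<bullet> cplx_J y = 0)"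

definition lagrangian_basis :: "(complex^'n) set \<Rightarrow> bool"
  where "lagrangian_basis B \<longleftrightarrow> isotropic_set B \<and> card B = CARD('n)"

lemma isotropic_set_cplx_J_image: "isotropic_set B \<Longrightarrow> isotropic_set (cplx_J ` B)"
  by (auto simp: isotropic_set_def inner_cplx_J_left)

lemma isotropic_set_insert:
  assumes B: "isotropic_set B" and u: "norm u = 1"
    and uB: "\<And>y. y \<in> B \<Longrightarrow> u \<bullet> y = 0" "\<And>y. y \<in> B \<Longrightarrow> u \<bullet> cplx_J y = 0"
  shows "isotropic_set (insert u B)"
proof -
  have "y \<bullet> u = 0" "y \<bullet> cplx_J u = 0" if "y \<in> B" for y
    using uB[OF that] inner_cplx_J_left[of u y] by (simp_all add: inner_commute)
  with assms show ?thesis by (simp add: isotropic_set_def)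
qed

lemma isotropic_set_subset: "isotropic_set B \<Longrightarrow> C \<subseteq> B \<Longrightarrow> isotropic_set C"
  unfolding isotropic_set_def by (meson finite_subset subsetD)

lemma lagrangian_basis_cplx_J_image: "lagrangian_basis B \<Longrightarrow> lagrangian_basis (cplx_J ` B)"
  by (simp add: lagrangian_basis_def isotropic_set_cplx_J_image card_image
      inj_on_subset[OF inj_cplx_J])

lemma orthonormal_independent:
  fixes B :: "'a::euclidean_space set"
  assumes "\<forall>x\<in>B. norm x = 1" "\<forall>x\<in>B. \<forall>y\<in>B. x \<noteq> y \<longrightarrow> x \<bullet> y = 0"
  shows "pairwise orthogonal B" "independent B"
proof -
  show p: "pairwise orthogonal B"
    using assms(2) by (auto simp: pairwise_def orthogonal_def)
  show "independent B"
    using assms(1) by (intro pairwise_orthogonal_independent[OF p]) auto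
qed

lemma dim_span_isotropic_set: "isotropic_set B \<Longrightarrow> dim (span B) = card B"
  using orthonormal_independent[of B]
  by (simp add: isotropic_set_def dim_eq_card_independent)

text \<open>Isotropy places J W inside the orthogonal complement of W = \<open>span B\<close>; both
  have dimension \<open>CARD('n)\<close>, so they coincide.\<close>

lemma lagrangian_basis_span:
  fixes B :: "(complex^'n) set"
  assumes B: "lagrangian_basis B"
  shows "orthonormal_basis_of (span B) B" "span B \<in> LAG"
proof -
  show "orthonormal_basis_of (span B) B"
    using B orthonormal_independent[of B]
    by (simp add: lagrangian_basis_def isotropic_set_def orthonormal_basis_of_def)
  have sub: "span (cplx_J ` B) \<subseteq> orthogonal_comp (span B)"
  proof (rule span_minimal)
    show "cplx_J ` B \<subseteq> orthogonal_comp (span B)"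
    proof (clarsimp simp: orthogonal_comp_def)
      fix x y assume "x \<in> B" "y \<in> span B"
      show "orthogonal y (cplx_J x)"
        using \<open>y \<in> span B\<close>
        by (rule orthogonal_to_span[THEN orthogonal_commute[THEN iffD1]])
           (use \<open>x \<in> B\<close> B in \<open>auto simp: orthogonal_def lagrangian_basis_def isotropic_set_def inner_commute\<close>)
    qed
  qed (rule subspace_orthogonal_comp)
  have dimB: "dim (span B) = CARD('n)"
    using B dim_span_isotropic_set[of B] by (simp add: lagrangian_basis_def)
  have dimJ: "dim (span (cplx_J ` B)) = CARD('n)"
    using lagrangian_basis_cplx_J_image[OF B] dim_span_isotropic_set[of "cplx_J ` B"]
    by (simp add: lagrangian_basis_def)
  have "dim (orthogonal_comp (span B)) + dim (span B) = DIM(complex^'n)"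
    using dim_subspace_orthogonal_to_vectors[of "span B" UNIV] 
    by (simp add: orthogonal_comp_def)
  then have "dim (orthogonal_comp (span B)) = CARD('n)" using dimB by simp
  then have "span (cplx_J ` B) = orthogonal_comp (span B)"
    using sub dimJ by (intro subspace_dim_equal) (auto simp: subspace_orthogonal_comp)
  then show "span B \<in> LAG"
    using dimB by (simp add: LAG_def linear_span_image[OF linear_cplx_J, symmetric])
qed

lemma LAG_imp_lagrangian_basis:
  fixes W :: "(complex^'n) set"
  assumes W: "W \<in> LAG"
  obtains B where "lagrangian_basis B" "orthonormal_basis_of W B"
proof -
  obtain B where B: "orthonormal_basis_of W B"
    using orthonormal_basis_of_exists[of W] W by (auto simp: LAG_def)
  then have BW: "B \<subseteq> W" "span B = W" by (auto simp: orthonormal_basis_of_def span_base)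
  have o: "x \<bullet> y = 0" if "x \<in> B" "y \<in> B" "x \<noteq> y" for x y
    using B that by (auto simp: orthonormal_basis_of_def pairwise_def orthogonal_def)
  have J: "x \<bullet> cplx_J y = 0" if "x \<in> B" "y \<in> B" for x y
  proof -
    have "cplx_J y \<in> orthogonal_comp W" using W that BW by (auto simp: LAG_def)
    then show ?thesis using that BW by (auto simp: orthogonal_comp_def orthogonal_def)
  qed
  have "isotropic_set B"
    using B o J orthonormal_basis_of_finite[OF B] by (simp add: isotropic_set_def orthonormal_basis_of_def)
  moreover from dim_span_isotropic_set[OF this] W BW have "card B = CARD('n)"
    by (simp add: LAG_def)
  ultimately show ?thesis using that B by (simp add: lagrangian_basis_def)
qed

text \<open>\<open>B\<close> together with its image under J is a real orthonormal basis of the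
  whole space, and the trace does not depend on the basis. Thus the full trace splits into traces on
  two Lagrangian planes.\<close>

lemma sum_Basis_lagrangian_basis:
  fixes B :: "(complex^'n) set" and A :: "complex^'n \<Rightarrow> complex^'n \<Rightarrow> real"
  assumes B: "lagrangian_basis B" and A: "bilinear A"
  shows "(\<Sum>b\<in>Basis. A b b) = (\<Sum>e\<in>B. A e e) + (\<Sum>e\<in>B. A (cplx_J e) (cplx_J e))"
proof -
  have iso: "isotropic_set B" using B by (simp add: lagrangian_basis_def)
  have disj: "B \<inter> cplx_J ` B = {}"
  proof (rule ccontr)
    assume "B \<inter> cplx_J ` B \<noteq> {}"
    then obtain y where "y \<in> B" "cplx_J y \<in> B" by blast
    with iso have "cplx_J y \<bullet> cplx_J y = 0" "norm (cplx_J y) = 1" unfolding isotropic_set_def by blast+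
    then show False by (simp add: norm_eq_1)
  qed
  have 1: "\<forall>x\<in>B \<union> cplx_J ` B. norm x = 1"
    using iso by (auto simp: isotropic_set_def)
  have 2: "\<forall>x\<in>B \<union> cplx_J ` B. \<forall>y\<in>B \<union> cplx_J ` B. x \<noteq> y \<longrightarrow> x \<bullet> y = 0"
    using iso isotropic_set_cplx_J_image[OF iso]
    by (auto simp: isotropic_set_def inner_cplx_J_left)
  have "card (B \<union> cplx_J ` B) = 2 * CARD('n)"
    using B disj iso by (simp add: card_Un_disjoint lagrangian_basis_def isotropic_set_def card_image
        inj_on_subset[OF inj_cplx_J])
  then have "span (B \<union> cplx_J ` B) = UNIV"
    using orthonormal_independent(2)[OF 1 2] card_eq_dim[of "B \<union> cplx_J ` B" UNIV] iso
    by (auto simp: isotropic_set_def)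
  then have "orthonormal_basis_of UNIV (B \<union> cplx_J ` B)"
    using 1 orthonormal_independent(1)[OF 1 2] by (simp add: orthonormal_basis_of_def)
  moreover have "orthonormal_basis_of UNIV (Basis :: (complex^'n) set)"
    by (auto simp: orthonormal_basis_of_def pairwise_def orthogonal_def inner_not_same_Basis)
  ultimately have "(\<Sum>b\<in>Basis. A b b) = (\<Sum>e\<in>B \<union> cplx_J ` B. A e e)"
    using trace_on_eq[OF A] by metis
  also have "\<dots> = (\<Sum>e\<in>B. A e e) + (\<Sum>e\<in>cplx_J ` B. A e e)"
    using iso disj by (intro sum.union_disjoint) (auto simp: isotropic_set_def)
  also have "(\<Sum>e\<in>cplx_J ` B. A e e) = (\<Sum>e\<in>B. A (cplx_J e) (cplx_J e))"
    by (simp add: sum.reindex inj_on_subset[OF inj_cplx_J])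
  finally show ?thesis .
qed

text \<open>While \<open>B\<close> has fewer than \<open>CARD('n)\<close> elements, \<open>B\<close>
  and its image under J span a proper real subspace; any unit vector orthogonal to it extends
  \<open>B\<close>.\<close>

lemma lagrangian_basis_exists:
  fixes e :: "complex^'n"
  assumes e: "norm e = 1"
  obtains B where "lagrangian_basis B" "e \<in> B"
proof -
  have "\<exists>B. isotropic_set B \<and> e \<in> B \<and> card B = Suc k" if "Suc k \<le> CARD('n)" for k
    using that
  proof (induction k)
    case 0
    show ?case by (intro exI[of _ "{e}"]) (simp add: isotropic_set_def e)
  next
    case (Suc k)
    then obtain B where B: "isotropic_set B" "e \<in> B" "card B = Suc k" by auto
    have fin: "finite B" using B by (simp add: isotropic_set_def)
    have "dim (B \<union> cplx_J ` B) \<le> card (B \<union> cplx_J ` B)" using fin by (intro dim_le_card') auto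
    also have "\<dots> \<le> card B + card (cplx_J ` B)" by (rule card_Un_le)
    also have "\<dots> \<le> 2 * Suc k" using B card_image_le[OF fin, of cplx_J] by simp
    also have "\<dots> < DIM(complex^'n)" using Suc.prems by simp
    finally obtain x where x: "x \<noteq> 0" "\<And>y. y \<in> span (B \<union> cplx_J ` B) \<Longrightarrow> orthogonal x y"
      using orthogonal_to_subspace_exists by blast
    define u where "u = (1 / norm x) *\<^sub>R x"
    have u: "norm u = 1" using x by (simp add: u_def)
    have uo: "u \<bullet> y = 0" "u \<bullet> cplx_J y = 0" if "y \<in> B" for y
      using x(2)[of y] x(2)[of "cplx_J y"] that by (auto simp: u_def orthogonal_def span_base)
    have "u \<notin> B" using uo(1) u by (metis norm_eq_1 zero_neq_one)
    moreover have "isotropic_set (insert u B)"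
      by (rule isotropic_set_insert[OF B(1) u uo])
    ultimately show ?case using B fin by (intro exI[of _ "insert u B"]) simp
  qed
  from this[of "CARD('n) - 1"] show ?thesis
    using that by (auto simp: lagrangian_basis_def)
qed

text \<open>Multiplying one member of a unitary basis by the imaginary unit leaves it unitary.
  Comparing traces on the two spans isolates the values of a form at \<open>e\<close> and at J
  e.\<close>

lemma lagrangian_basis_swap:
  assumes B: "lagrangian_basis B" and e: "e \<in> B"
  shows "lagrangian_basis (insert (cplx_J e) (B - {e}))" "cplx_J e \<notin> B - {e}"
proof -
  have iso: "isotropic_set B" using B by (simp add: lagrangian_basis_def)
  show n: "cplx_J e \<notin> B - {e}"
  proof
    assume "cplx_J e \<in> B - {e}"
    with iso e have "cplx_J e \<bullet> cplx_J e = 0" "norm (cplx_J e) = 1"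
      unfolding isotropic_set_def by blast+
    then show False by (simp add: norm_eq_1)
  qed
  have "isotropic_set (insert (cplx_J e) (B - {e}))"
  proof (rule isotropic_set_insert)
    show "isotropic_set (B - {e})" using iso isotropic_set_subset by blast
    show "norm (cplx_J e) = 1" using iso e by (simp add: isotropic_set_def)
    fix y assume y: "y \<in> B - {e}"
    then have "y \<in> B" "e \<noteq> y" by auto
    then have "e \<bullet> cplx_J y = 0" "e \<bullet> y = 0" using iso e by (simp_all add: isotropic_set_def)
    then show "cplx_J e \<bullet> y = 0" "cplx_J e \<bullet> cplx_J y = 0"
      by (simp_all only: inner_cplx_J_left[of e y] inner_cplx_J_cplx_J minus_zero)
  qed
  moreover have "card (insert (cplx_J e) (B - {e})) = card B"
    using n card_Suc_Diff1[of B e] e iso by (simp add: isotropic_set_def)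
  ultimately show "lagrangian_basis (insert (cplx_J e) (B - {e}))"
    using B by (simp add: lagrangian_basis_def)
qed

section \<open>Forms nonnegative on Lagrangian planes, and traceless hermitian forms\<close>

lemma P_LAG_sum_nonneg:
  assumes "A \<in> P_LAG" "lagrangian_basis B"
  shows "(\<Sum>e\<in>B. A e e) \<ge> 0"
  using assms lagrangian_basis_span[OF assms(2)] trace_on_eq[of A "span B" B]
  by (auto simp: P_LAG_def Sym2_def)

lemma P_LAG_sum_Basis_nonneg:
  fixes A :: "complex^'n \<Rightarrow> complex^'n \<Rightarrow> real"
  assumes "A \<in> P_LAG"
  shows "(\<Sum>b\<in>Basis. A b b) \<ge> 0"
proof -
  obtain u :: "complex^'n" where "norm u = 1" using vector_choose_size zero_le_one by blast
  then obtain B :: "(complex^'n) set" where B: "lagrangian_basis B"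
    using lagrangian_basis_exists by blast
  have "(\<Sum>e\<in>cplx_J ` B. A e e) \<ge> 0"
    by (rule P_LAG_sum_nonneg[OF assms lagrangian_basis_cplx_J_image[OF B]])
  then show ?thesis
    using P_LAG_sum_nonneg[OF assms B] sum_Basis_lagrangian_basis[OF B, of A] assms
    by (simp add: sum.reindex inj_on_subset[OF inj_cplx_J] P_LAG_def Sym2_def)
qed

text \<open>Symmetric J-invariant real forms are the real parts of complex hermitian forms; the sum
  over the real \<open>Basis\<close> is twice the trace of the hermitian matrix.\<close>

definition traceless_hermitian :: "(complex^'n \<Rightarrow> complex^'n \<Rightarrow> real) \<Rightarrow> bool"
  where "traceless_hermitian A \<longleftrightarrow> A \<in> Sym2 \<and> (\<forall>v w. A (cplx_J v) (cplx_J w) = A v w) \<and>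
    (\<Sum>b\<in>Basis. A b b) = 0"

lemma P_LAG_both_traceless_hermitian:
  fixes A :: "complex^'n \<Rightarrow> complex^'n \<Rightarrow> real"
  assumes A: "A \<in> P_LAG" "(\<lambda>v w. - A v w) \<in> P_LAG"
  shows "traceless_hermitian A"
proof -
  have sym: "A v w = A w v" for v w using A by (auto simp: P_LAG_def Sym2_def)
  have bil: "bilinear A" using A by (auto simp: P_LAG_def Sym2_def)
  have sum0: "(\<Sum>e\<in>B. A e e) = 0" if "lagrangian_basis B" for B
    using P_LAG_sum_nonneg[OF A(1) that] P_LAG_sum_nonneg[OF A(2) that] by (simp add: sum_negf)
  have unit: "A (cplx_J e) (cplx_J e) = A e e" if e: "norm e = 1" for e
  proof -
    obtain B where B: "lagrangian_basis B" "e \<in> B" using lagrangian_basis_exists[OF e] by blast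
    have fin: "finite B" using B by (simp add: lagrangian_basis_def isotropic_set_def)
    have "A e e + (\<Sum>e\<in>B - {e}. A e e) = 0"
      using sum0[OF B(1)] sum.remove[OF fin B(2), of "\<lambda>e. A e e"] by simp
    moreover have "A (cplx_J e) (cplx_J e) + (\<Sum>e\<in>B - {e}. A e e) = 0"
      using sum0[OF lagrangian_basis_swap(1)[OF B]] lagrangian_basis_swap(2)[OF B] fin by simp
    ultimately show ?thesis by simp
  qed
  have diag: "A (cplx_J v) (cplx_J v) = A v v" for v
  proof (cases "v = 0")
    case True
    then show ?thesis by (simp add: linear_0[OF linear_cplx_J])
  next
    case False
    define e where "e = (1 / norm v) *\<^sub>R v"
    have e: "norm e = 1" "v = norm v *\<^sub>R e" using False by (auto simp: e_def)
    show ?thesis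
      using unit[OF e(1)]
      by (subst (1 2 3 4) e(2))
         (simp add: linear_cmul[OF linear_cplx_J] bilinear_lmul[OF bil] bilinear_rmul[OF bil])
  qed
  \<comment> \<open>Polarization carries J-invariance from the diagonal to all pairs.\<close>
  have pol: "2 * A v w = A (v + w) (v + w) - A v v - A w w" for v w
    by (simp add: bilinear_ladd[OF bil] bilinear_radd[OF bil] sym[of w v])
  have "A (cplx_J v) (cplx_J w) = A v w" for v w
    using pol[of v w] pol[of "cplx_J v" "cplx_J w"] diag[of "v + w"] diag[of v] diag[of w]
    by (simp add: linear_add[OF linear_cplx_J])
  moreover have "(\<Sum>b\<in>Basis. A b b) = 0"
    using P_LAG_sum_Basis_nonneg[OF A(1)] P_LAG_sum_Basis_nonneg[OF A(2)] by (simp add: sum_negf)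
  ultimately show ?thesis using bil sym by (auto simp: traceless_hermitian_def Sym2_def)
qed

text \<open>By J-invariance the two halves of the full trace in
  \<open>sum_Basis_lagrangian_basis\<close> are equal, so each is zero.\<close>

lemma traceless_hermitian_trace_on_LAG:
  assumes "traceless_hermitian A" "lagrangian_basis B"
  shows "(\<Sum>e\<in>B. A e e) = 0"
  using sum_Basis_lagrangian_basis[OF assms(2), of A] assms(1)
  by (simp add: traceless_hermitian_def Sym2_def)

lemma lagrangian_basis_axis: "lagrangian_basis (range (\<lambda>k::'n::finite. axis k (1::complex)))"
proof -
  have J: "cplx_J (axis l 1) = axis l \<i>" for l :: 'n
    by (auto simp: cplx_J_def axis_def vec_eq_iff)
  have "inj (\<lambda>k::'n. axis k (1::complex))" by (auto simp: inj_def axis_eq_axis)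
  then show ?thesis
    by (auto simp: lagrangian_basis_def isotropic_set_def inner_axis_axis axis_eq_axis J card_image
        inner_complex_def)
qed

section \<open>Second order jets of plurisubharmonic functions\<close>

lemma psh_test:
  assumes psh: "lagrangian_psh \<Omega> (\<lambda>z. ereal (h z))"
    and "open U" "x \<in> U" "U \<subseteq> \<Omega>" "smooth_on \<phi> U" "\<And>y. y \<in> U \<Longrightarrow> h y \<le> \<phi> y" "h x = \<phi> x"
  shows "second_derivative \<phi> x \<in> P_LAG"
proof -
  have "x \<in> \<Omega>" "\<forall>y\<in>U. ereal (h y) \<le> ereal (\<phi> y)" "ereal (h x) = ereal (\<phi> x)" using assms by auto
  with assms(2-5) psh show ?thesis unfolding lagrangian_psh_def by blast
qed

lemma psh_imp_visc_subharmonic: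
  assumes "lagrangian_psh \<Omega> (\<lambda>z. ereal (h z))" "S \<subseteq> \<Omega>"
  shows "visc_subharmonic S h"
  unfolding visc_subharmonic_def
proof (intro allI impI, elim conjE)
  fix x U \<phi>
  assume *: "open U" "x \<in> U" "U \<subseteq> S" "rpoly \<phi>" "\<forall>y\<in>U. h y \<le> \<phi> y" "h x = \<phi> x"
  then have "second_derivative \<phi> x \<in> P_LAG"
    using assms rpoly_smooth_on[of \<phi> U] by (intro psh_test[OF assms(1), of U]) auto
  from P_LAG_sum_Basis_nonneg[OF this] show "laplacian \<phi> x \<ge> 0"
    by (simp add: second_derivative_eq laplacian_def)
qed

lemma linear_shift_has_derivative:
  fixes f :: "'a::euclidean_space \<Rightarrow> real"
  assumes "linear f"
  shows "((\<lambda>z. f (z - x)) has_derivative f) (at z)"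
  using has_derivative_diff[OF linear_imp_has_derivative[OF assms] has_derivative_const[of "f x"]]
  by (simp add: linear_diff[OF assms])

lemma Sym2_diag_has_derivative:
  assumes "Q \<in> Sym2"
  shows "((\<lambda>y. Q (y - x) (y - x)) has_derivative (\<lambda>v. 2 * Q v (z - x))) (at z)"
proof -
  have "bounded_bilinear Q" using assms bilinear_conv_bounded_bilinear by (auto simp: Sym2_def)
  moreover have "((\<lambda>y. y - x) has_derivative (\<lambda>v. v)) (at z)"
    by (auto intro!: derivative_eq_intros)
  ultimately have "((\<lambda>y. Q (y - x) (y - x)) has_derivative (\<lambda>v. Q (z - x) v + Q v (z - x))) (at z)"
    using bounded_bilinear.FDERIV by blast
  moreover have "Q (z - x) v = Q v (z - x)" for v using assms by (auto simp: Sym2_def)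
  ultimately show ?thesis by simp
qed

text \<open>Expanding one argument of \<open>Q\<close> over \<open>Basis\<close> exhibits Q z z as a
  sum of products of linear functions; \<open>rpoly_smooth_on\<close> then makes jets admissible as
  test functions.\<close>

lemma rpoly_quadratic:
  fixes \<l> :: "'a::euclidean_space \<Rightarrow> real"
  assumes l: "linear \<l>" and Q: "Q \<in> Sym2"
  shows "rpoly (\<lambda>z. c + \<l> (z - x) + Q (z - x) (z - x) / 2)"
proof -
  have bil: "bilinear Q" using Q by (simp add: Sym2_def)
  have "Q z z = (\<Sum>b\<in>Basis. (z \<bullet> b) * Q b z)" for z
  proof -
    have lin: "linear (\<lambda>v. Q v z)" using bil by (simp add: bilinear_def)
    have "Q (\<Sum>b\<in>Basis. (z \<bullet> b) *\<^sub>R b) z = (\<Sum>b\<in>Basis. Q ((z \<bullet> b) *\<^sub>R b) z)"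
      by (rule linear_sum[OF lin])
    then show ?thesis by (simp add: euclidean_representation bilinear_lmul[OF bil])
  qed
  moreover have "bounded_linear (Q b)" for b
    using bil by (auto simp: bilinear_def linear_conv_bounded_linear)
  then have "rpoly (\<lambda>z. \<Sum>b\<in>Basis. (z \<bullet> b) * Q b z)"
    by (intro real_polynomial_function_sum rpoly_mult rpoly_linear bounded_linear_inner_left) auto
  ultimately have q: "rpoly (\<lambda>z. Q z z)" by simp
  have "rpoly (\<lambda>z. (c + \<l> z) + (1/2) * Q z z)"
    using l by (intro rpoly_add rpoly_mult rpoly_const rpoly_linear q) (simp add: linear_conv_bounded_linear)
  from rpoly_affine[OF this linear_id, of "-x"] show ?thesis by (simp add: field_simps)
qed

lemma second_derivative_quadratic:
  fixes \<l> :: "'a::euclidean_space \<Rightarrow> real"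
  assumes l: "linear \<l>" and Q: "Q \<in> Sym2"
  shows "second_derivative (\<lambda>z. c + \<l> (z - x) + Q (z - x) (z - x) / 2) y v w = Q v w"
proof -
  have bil: "bilinear Q" using Q by (simp add: Sym2_def)
  have "dir_deriv v (\<lambda>z. c + \<l> (z - x) + Q (z - x) (z - x) / 2) z = \<l> v + Q v (z - x)" for z
  proof (rule dir_deriv_eqI)
    from has_derivative_add[OF has_derivative_add[OF has_derivative_const[of c]
          linear_shift_has_derivative[OF l]]
        has_derivative_mult_right[OF Sym2_diag_has_derivative[OF Q], of "1/2"]]
    show "((\<lambda>z. c + \<l> (z - x) + Q (z - x) (z - x) / 2) has_derivative (\<lambda>v. \<l> v + Q v (z - x))) (at z)"
      by simp
  qed
  then have 1: "dir_deriv v (\<lambda>z. c + \<l> (z - x) + Q (z - x) (z - x) / 2) = (\<lambda>z. \<l> v + Q v (z - x))"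
    by blast
  have "linear (Q v)" using bil by (simp add: bilinear_def)
  from has_derivative_add[OF has_derivative_const[of "\<l> v"] linear_shift_has_derivative[OF this]]
  have "((\<lambda>z. \<l> v + Q v (z - x)) has_derivative (\<lambda>w. Q v w)) (at y)" by simp
  from dir_deriv_eqI[OF this, of w] show ?thesis unfolding second_derivative_eq 1 .
qed

lemma Sym2_add_inner:
  assumes "Q \<in> Sym2"
  shows "(\<lambda>v w. Q v w + c * (v \<bullet> w)) \<in> Sym2"
proof -
  have Q: "bilinear Q" "\<And>v w. Q v w = Q w v" using assms by (auto simp: Sym2_def)
  have "bilinear (\<lambda>v w. Q v w + c * (v \<bullet> w))"
    unfolding bilinear_def
    by (intro conjI allI linearI)
       (simp_all add: bilinear_ladd[OF Q(1)] bilinear_radd[OF Q(1)] bilinear_lmul[OF Q(1)]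
          bilinear_rmul[OF Q(1)] inner_add_left inner_add_right algebra_simps)
  then show ?thesis using Q(2) by (simp add: Sym2_def inner_commute)
qed

text \<open>The quadratic jet alone need not lie above \<open>h\<close>. Adding \<epsilon> |y|^2 / 2
  absorbs the cubic error on a small ball and gives a test function with Hessian Q + \<epsilon> I;
  letting \<epsilon> tend to 0 keeps the trace inequalities.\<close>

lemma psh_second_order_jet:
  fixes \<Omega> :: "(complex^'n) set"
  assumes psh: "lagrangian_psh \<Omega> (\<lambda>z. ereal (h z))" and \<Omega>: "open \<Omega>" "x \<in> \<Omega>"
    and l: "linear \<l>" and Q: "Q \<in> Sym2" and d: "d > 0"
    and jet: "\<And>y. norm y < d \<Longrightarrow> h (x + y) \<le> h x + \<l> y + Q y y / 2 + C * norm y ^ 3"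
  shows "Q \<in> P_LAG"
proof -
  have ge: "(\<Sum>e\<in>B. Q e e) + \<epsilon> * real CARD('n) \<ge> 0"
    if B: "lagrangian_basis B" and \<epsilon>: "\<epsilon> > 0" for B :: "(complex^'n) set" and \<epsilon>
  proof -
    define Q' where "Q' = (\<lambda>v w. Q v w + \<epsilon> * (v \<bullet> w))"
    have Q': "Q' \<in> Sym2" unfolding Q'_def by (rule Sym2_add_inner[OF Q])
    obtain r where r: "r > 0" "ball x r \<subseteq> \<Omega>" using \<Omega> openE by blast
    \<comment> \<open>The last bound makes C |y|^3 at most \<epsilon> |y|^2 / 2; the form |C| + 1
      covers zero and negative \<open>C\<close>.\<close>
    define s where "s = min r (min d (\<epsilon> / (2 * (\<bar>C\<bar> + 1))))"
    have s: "s > 0" "s \<le> r" "s \<le> d" "s \<le> \<epsilon> / (2 * (\<bar>C\<bar> + 1))"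
      using r d \<epsilon> by (auto simp: s_def)
    let ?\<phi> = "\<lambda>z. h x + \<l> (z - x) + Q' (z - x) (z - x) / 2"
    have "h z \<le> ?\<phi> z" if "z \<in> ball x s" for z
    proof -
      define y where "y = z - x"
      have y: "norm y < s" using that by (simp add: y_def dist_norm norm_minus_commute)
      have "C * norm y \<le> (\<bar>C\<bar> + 1) * norm y" by (intro mult_right_mono) auto
      also have "\<dots> \<le> (\<bar>C\<bar> + 1) * (\<epsilon> / (2 * (\<bar>C\<bar> + 1)))"
        using y s(4) by (intro mult_left_mono) auto
      also have "\<dots> = \<epsilon> / 2" by (simp add: field_simps add_nonneg_eq_0_iff)
      finally have "C * norm y * norm y ^ 2 \<le> \<epsilon> / 2 * norm y ^ 2"
        by (rule mult_right_mono) simp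
      then have "C * norm y ^ 3 \<le> \<epsilon> * (y \<bullet> y) / 2"
        by (simp add: power2_eq_square power3_eq_cube dot_square_norm mult.assoc)
      moreover have "h (x + y) \<le> h x + \<l> y + Q y y / 2 + C * norm y ^ 3"
        using jet y s by simp
      ultimately show ?thesis by (simp add: y_def Q'_def add_divide_distrib)
    qed
    moreover have "h x = ?\<phi> x"
      using l Q' by (simp add: linear_0 bilinear_lzero Sym2_def)
    moreover have "ball x s \<subseteq> \<Omega>" using r s by auto
    moreover have "smooth_on ?\<phi> (ball x s)" by (intro rpoly_smooth_on rpoly_quadratic l Q')
    ultimately have "second_derivative ?\<phi> x \<in> P_LAG"
      using s(1) by (intro psh_test[OF psh open_ball[of x s]]) auto
    moreover have "second_derivative ?\<phi> x = Q'"
      using second_derivative_quadratic[OF l Q'] by blast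
    ultimately have "Q' \<in> P_LAG" by simp
    from P_LAG_sum_nonneg[OF this B] have "(\<Sum>e\<in>B. Q e e) + \<epsilon> * (\<Sum>e\<in>B. e \<bullet> e) \<ge> 0"
      by (simp add: Q'_def sum.distrib sum_distrib_left)
    moreover have "(\<Sum>e\<in>B. e \<bullet> e) = real CARD('n)"
      using B by (simp add: lagrangian_basis_def isotropic_set_def norm_eq_1)
    ultimately show ?thesis by simp
  qed
  have "trace_on W Q \<ge> 0" if W: "W \<in> LAG" for W
  proof -
    obtain B where B: "lagrangian_basis B" "orthonormal_basis_of W B"
      using LAG_imp_lagrangian_basis[OF W] by blast
    have "trace_on W Q = (\<Sum>e\<in>B. Q e e)"
      using Q by (intro trace_on_eq B) (simp add: Sym2_def)
    moreover have "(\<Sum>e\<in>B. Q e e) \<ge> 0"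
    proof (rule ccontr)
      assume neg: "\<not> (\<Sum>e\<in>B. Q e e) \<ge> 0"
      \<comment> \<open>Used as \<epsilon>, this value cancels only half of the negative trace,
        which contradicts \<open>ge\<close>.\<close>
      then have "- (\<Sum>e\<in>B. Q e e) / (2 * real CARD('n)) > 0"
        by (intro divide_pos_pos) auto
      from ge[OF B(1) this] neg show False by simp
    qed
    ultimately show ?thesis by simp
  qed
  then show ?thesis using Q by (simp add: P_LAG_def)
qed

section \<open>Derivatives of uniform limits of harmonic polynomials\<close>

text \<open>The gradient estimate applied to differences w m - w n makes the derivatives uniformly
  Cauchy on the ball shrunk by \<open>d\<close>. Only the existence of a limit is asserted; it is
  identified pointwise where it is used.\<close>

lemma uniform_limit_dir_deriv_harmonic:
  fixes w :: "nat \<Rightarrow> 'a::euclidean_space \<Rightarrow> real"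
  assumes h: "\<And>k. harmonic_poly (w k)" and lim: "uniform_limit (cball a (r + d)) w l sequentially"
    and d: "d > 0"
  shows "\<exists>l'. uniform_limit (cball a r) (\<lambda>k. dir_deriv e (w k)) l' sequentially"
proof -
  \<comment> \<open>Adding 1 keeps \<open>C\<close> positive even for e = 0, so that it may be
    divided by.\<close>
  define C where "C = (real DIM('a))\<^sup>2 / d * norm e + 1"
  have C: "C > 0" using d by (simp add: C_def add_nonneg_pos)
  have est: "\<bar>dir_deriv e (w m) x - dir_deriv e (w n) x\<bar> \<le> C * M"
    if M: "\<And>y. y \<in> cball a (r + d) \<Longrightarrow> \<bar>w m y - w n y\<bar> \<le> M" and x: "x \<in> cball a r" for m n M x
  proof -
    have sub: "y \<in> cball a (r + d)" if "y \<in> cball x d" for y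
      using that x dist_triangle[of a y x] by simp
    have M0: "M \<ge> 0" using M[OF sub[of x]] d by fastforce
    have "\<bar>dir_deriv e (\<lambda>x. w m x - w n x) x\<bar> \<le> (real DIM('a))\<^sup>2 / d * M * norm e"
      by (rule harmonic_gradient_estimate[OF harmonic_poly_diff[OF h h] d]) (use M sub in blast)
    then show ?thesis
      using h M0 by (simp add: harmonic_poly_def dir_deriv_diff C_def algebra_simps)
  qed
  have "uniformly_Cauchy_on (cball a r) (\<lambda>k. dir_deriv e (w k))"
    unfolding uniformly_Cauchy_on_def
  proof (intro allI impI)
    fix \<epsilon> :: real assume \<epsilon>: "\<epsilon> > 0"
    then have "\<epsilon> / (4 * C) > 0" using C by simp
    from uniform_limitD[OF lim this] obtain K where
      K: "\<And>k x. k \<ge> K \<Longrightarrow> x \<in> cball a (r + d) \<Longrightarrow> dist (w k x) (l x) < \<epsilon> / (4 * C)"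
      unfolding eventually_sequentially by blast
    have "dist (dir_deriv e (w m) x) (dir_deriv e (w n) x) < \<epsilon>"
      if "x \<in> cball a r" "m \<ge> K" "n \<ge> K" for x m n
    proof -
      have "\<bar>w m y - w n y\<bar> \<le> \<epsilon> / (2 * C)" if "y \<in> cball a (r + d)" for y
        using K[OF \<open>m \<ge> K\<close> that] K[OF \<open>n \<ge> K\<close> that] by (simp add: dist_real_def field_simps)
      from est[OF this \<open>x \<in> cball a r\<close>] show ?thesis using \<epsilon> C by (simp add: dist_real_def)
    qed
    then show "\<exists>M. \<forall>x\<in>cball a r. \<forall>m\<ge>M. \<forall>n\<ge>M. dist (dir_deriv e (w m) x) (dir_deriv e (w n) x) < \<epsilon>"
      by blast
  qed
  from Cauchy_uniformly_convergent[OF this] show ?thesis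
    by (auto simp: uniformly_convergent_on_def)
qed

text \<open>For the limit 0 the gradient estimate, being linear in the supremum, also gives the
  limit of the derivatives.\<close>

lemma uniform_limit_dir_deriv_harmonic_0:
  fixes w :: "nat \<Rightarrow> 'a::euclidean_space \<Rightarrow> real"
  assumes h: "\<And>k. harmonic_poly (w k)" and lim: "uniform_limit (cball a (r + d)) w (\<lambda>x. 0) sequentially"
    and d: "d > 0"
  shows "uniform_limit (cball a r) (\<lambda>k. dir_deriv e (w k)) (\<lambda>x. 0) sequentially"
  unfolding uniform_limit_iff
proof (intro allI impI)
  fix \<epsilon> :: real assume \<epsilon>: "\<epsilon> > 0"
  define C where "C = (real DIM('a))\<^sup>2 / d * norm e + 1"
  have C: "C > 0" using d by (simp add: C_def add_nonneg_pos)
  have "\<epsilon> / C > 0" using \<epsilon> C by simp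
  from uniform_limitD[OF lim this]
  show "\<forall>\<^sub>F n in sequentially. \<forall>x\<in>cball a r. dist (dir_deriv e (w n) x) 0 < \<epsilon>"
  proof (rule eventually_mono, intro ballI)
    fix n x assume n: "\<forall>x\<in>cball a (r + d). dist (w n x) 0 < \<epsilon> / C" and x: "x \<in> cball a r"
    have sub: "y \<in> cball a (r + d)" if "y \<in> cball x d" for y
      using that x dist_triangle[of a y x] by simp
    have "\<bar>dir_deriv e (w n) x\<bar> \<le> (real DIM('a))\<^sup>2 / d * (\<epsilon> / C) * norm e"
      by (rule harmonic_gradient_estimate[OF h d]) (use n sub in \<open>force simp: dist_real_def\<close>)
    also have "\<dots> = (C - 1) * (\<epsilon> / C)" by (simp add: C_def)
    also have "\<dots> < \<epsilon>" using C \<epsilon> by (simp add: field_simps)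
    finally show "dist (dir_deriv e (w n) x) 0 < \<epsilon>" by (simp add: dist_real_def)
  qed
qed

lemma linear_limit:
  fixes f :: "nat \<Rightarrow> 'a::real_vector \<Rightarrow> real"
  assumes "\<And>k. linear (f k)" "\<And>y. (\<lambda>k. f k y) \<longlonglongrightarrow> L y"
  shows "linear L"
proof (rule linearI)
  fix x y :: 'a and c :: real
  have "(\<lambda>k. f k (x + y)) \<longlonglongrightarrow> L x + L y"
    using tendsto_add[OF assms(2)[of x] assms(2)[of y]] by (simp add: linear_add[OF assms(1)])
  from LIMSEQ_unique[OF assms(2) this] show "L (x + y) = L x + L y" .
  have "(\<lambda>k. f k (c *\<^sub>R x)) \<longlonglongrightarrow> c * L x"
    using tendsto_mult_left[OF assms(2)[of x], of c] by (simp add: linear_cmul[OF assms(1)])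
  from LIMSEQ_unique[OF assms(2) this] show "L (c *\<^sub>R x) = c *\<^sub>R L x" by simp
qed

section \<open>Pluriharmonic functions are locally quadratic\<close>

text \<open>The jet of \<open>h\<close> is built from limits of derivatives of \<open>v k\<close> at
  \<open>x\<close>. The remainder bound passes to the limit because its constant involves
  \<open>v k\<close> only through the common bound \<open>M\<close>.\<close>

lemma second_order_jet_limit:
  fixes v :: "nat \<Rightarrow> 'a::euclidean_space \<Rightarrow> real"
  assumes harm: "\<And>k. harmonic_poly (v k)" and d: "d > 0"
    and lim: "uniform_limit (cball a (5 * d)) v h sequentially"
    and M: "\<And>k y. y \<in> cball a (5 * d) \<Longrightarrow> \<bar>v k y\<bar> \<le> M"
    and x: "x \<in> cball a d"
  shows "\<exists>\<l> Q C. linear \<l> \<and> Q \<in> Sym2 \<and> (\<forall>y. (\<lambda>k. dir_deriv y (v k) x) \<longlonglongrightarrow> \<l> y) \<and>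
    (\<forall>y z. (\<lambda>k. dir_deriv y (dir_deriv z (v k)) x) \<longlonglongrightarrow> Q y z) \<and>
    (\<forall>y. norm y \<le> d \<longrightarrow> \<bar>h (x + y) - h x - \<l> y - Q y y / 2\<bar> \<le> C * norm y ^ 3)"
proof -
  have rv: "rpoly (v k)" for k using harm by (simp add: harmonic_poly_def)
  have x4: "x \<in> cball a (4 * d)" using x d by simp
  have "\<exists>l. (\<lambda>k. dir_deriv y (v k) x) \<longlonglongrightarrow> l" for y
  proof -
    obtain l' where "uniform_limit (cball a (4 * d)) (\<lambda>k. dir_deriv y (v k)) l' sequentially"
      using uniform_limit_dir_deriv_harmonic[where w="v" and a=a and r="4 * d"
          and d="d" and l=h and e=y] harm lim d by auto
    from tendsto_uniform_limitI[OF this x4] show ?thesis by blast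
  qed
  then obtain \<l> where l: "\<And>y. (\<lambda>k. dir_deriv y (v k) x) \<longlonglongrightarrow> \<l> y" by metis
  have "\<exists>l. (\<lambda>k. dir_deriv y (dir_deriv z (v k)) x) \<longlonglongrightarrow> l" for y z
  proof -
    obtain l' where "uniform_limit (cball a (4 * d)) (\<lambda>k. dir_deriv z (v k)) l' sequentially"
      using uniform_limit_dir_deriv_harmonic[where w="v" and a=a and r="4 * d"
          and d="d" and l=h and e=z] harm lim d by auto
    then obtain l'' where
      "uniform_limit (cball a (3 * d)) (\<lambda>k. dir_deriv y (dir_deriv z (v k))) l'' sequentially"
      using uniform_limit_dir_deriv_harmonic[where w="\<lambda>k. dir_deriv z (v k)" and a=a and r="3 * d"
          and d=d and l=l' and e=y] harmonic_poly_dir_deriv[OF harm] d by auto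
    from tendsto_uniform_limitI[OF this, of x] show ?thesis using x d by auto
  qed
  then obtain Q where Q: "\<And>y z. (\<lambda>k. dir_deriv y (dir_deriv z (v k)) x) \<longlonglongrightarrow> Q y z" by metis
  have sym: "Q y z = Q z y" for y z
    using Q[of y z] Q[of z y] LIMSEQ_unique by (simp add: dir_deriv_commute[OF rv, of y z]) blast
  have linQ: "linear (\<lambda>y. Q y z)" for z
    by (rule linear_limit[OF rpoly_linear_dir[OF rpoly_dir_deriv[OF rv]] Q])
  moreover have "linear (Q z)" for z
    using linQ[of z] by (simp add: sym[of _ z])
  ultimately have "Q \<in> Sym2" using sym by (auto simp: Sym2_def bilinear_def)
  moreover have "linear \<l>" by (rule linear_limit[OF rpoly_linear_dir[OF rv] l])
  moreover have "\<bar>h (x + y) - h x - \<l> y - Q y y / 2\<bar> \<le> ((real DIM('a))\<^sup>2 / d) ^ 3 * M * norm y ^ 3"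
    if y: "norm y \<le> d" for y
  proof -
    have xy: "x \<in> cball a (5 * d)" "x + y \<in> cball a (5 * d)"
      using x y d dist_triangle[of a "x + y" x] by (auto simp: dist_norm)
    have "(\<lambda>k. \<bar>v k (x + y) - v k x - dir_deriv y (v k) x - dir_deriv y (dir_deriv y (v k)) x / 2\<bar>)
        \<longlonglongrightarrow> \<bar>h (x + y) - h x - \<l> y - Q y y / 2\<bar>"
      using lim xy by (intro tendsto_intros l Q tendsto_uniform_limitI[OF lim]) auto
    then show ?thesis
      by (rule LIMSEQ_le_const2) (use harmonic_second_order_bound[OF harm d M x y] in blast)
  qed
  ultimately show ?thesis using l Q by blast
qed

text \<open>The intermediate point of Taylor's formula moves with k, which is why the third
  derivatives are assumed to tend to 0 uniformly on a ball containing the whole segment.\<close>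

lemma rpoly_taylor_limit:
  fixes v :: "nat \<Rightarrow> 'a::euclidean_space \<Rightarrow> real"
  assumes rv: "\<And>k. rpoly (v k)"
    and lim: "(\<lambda>k. v k a) \<longlonglongrightarrow> h0" "(\<lambda>k. v k (a + y)) \<longlonglongrightarrow> h1"
      "(\<lambda>k. dir_deriv y (v k) a) \<longlonglongrightarrow> l" "(\<lambda>k. dir_deriv y (dir_deriv y (v k)) a) \<longlonglongrightarrow> q"
    and third: "uniform_limit (cball a (norm y)) (\<lambda>k. dir_deriv y (dir_deriv y (dir_deriv y (v k))))
      (\<lambda>x. 0) sequentially"
  shows "h1 = h0 + l + q / 2"
proof -
  let ?T = "\<lambda>k. dir_deriv y (dir_deriv y (dir_deriv y (v k)))"
  have "\<forall>k. \<exists>t. 0 < t \<and> t < 1 \<and> v k (a + y) = v k a + dir_deriv y (v k) a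
      + dir_deriv y (dir_deriv y (v k)) a / 2 + ?T k (a + t *\<^sub>R y) / 6"
    using rpoly_taylor[OF rv] by blast
  then obtain t where t: "\<And>k. 0 < t k" "\<And>k. t k < 1" and eq: "\<And>k. v k (a + y) = v k a + dir_deriv y (v k) a
      + dir_deriv y (dir_deriv y (v k)) a / 2 + ?T k (a + t k *\<^sub>R y) / 6"
    by metis
  have in_ball: "a + t k *\<^sub>R y \<in> cball a (norm y)" for k
    using t[of k] by (simp add: dist_norm mult_left_le_one_le)
  have "(\<lambda>k. ?T k (a + t k *\<^sub>R y)) \<longlonglongrightarrow> 0"
    unfolding tendsto_iff
  proof (intro allI impI)
    fix e :: real assume "e > 0"
    from uniform_limitD[OF third this]
    show "\<forall>\<^sub>F k in sequentially. dist (?T k (a + t k *\<^sub>R y)) 0 < e"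
      by (rule eventually_mono) (use in_ball in blast)
  qed
  then have "(\<lambda>k. v k (a + y)) \<longlonglongrightarrow> h0 + l + q / 2 + 0 / 6"
    unfolding eq by (intro tendsto_intros lim) simp_all
  from LIMSEQ_unique[OF lim(2) this] show ?thesis by simp
qed

text \<open>The third derivative \<open>T(u,v,w)\<close> is symmetric, and \<open>T(u,v,w) = T(u,Jv,Jw)\<close> for all arguments
  forces \<open>T = 0\<close>; here is the version with an error term, on the diagonal.\<close>

lemma third_derivative_J:
  fixes v :: "complex^'n \<Rightarrow> real"
  assumes "rpoly v"
  defines "S \<equiv> \<lambda>a b x. dir_deriv a (dir_deriv b v) x - dir_deriv (cplx_J a) (dir_deriv (cplx_J b) v) x"
  shows "dir_deriv y (dir_deriv y (dir_deriv y v)) x =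
    dir_deriv y (S y y) x + (1/2) * dir_deriv (cplx_J y) (S y (cplx_J y)) x"
proof -
  let ?T = "\<lambda>a b c. dir_deriv a (dir_deriv b (dir_deriv c v)) x"
  let ?j = "cplx_J y"
  have dS: "dir_deriv g (S a b) x = ?T g a b - ?T g (cplx_J a) (cplx_J b)" for g a b
    unfolding S_def by (simp add: dir_deriv_diff assms rpoly_dir_deriv)
  \<comment> \<open>Since J (J y) = -y, the derivative of \<open>S y (cplx_J y)\<close> along J y is
    T(Jy,y,Jy) + T(Jy,Jy,y), twice T(y,Jy,Jy) by symmetry. Half of it restores the term subtracted
    in the derivative of \<open>S y y\<close>.\<close>
  have neg: "?T ?j ?j (- y) = - ?T ?j ?j y"
    using dir_deriv_cmult[OF rpoly_dir_deriv[OF assms(1)], of _ "-1" y]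
      dir_deriv_cmult[OF rpoly_dir_deriv[OF rpoly_dir_deriv[OF assms(1)]], of _ "-1" _ y]
    by (simp add: dir_deriv_neg_dir[OF assms(1)])
  have "?T ?j y ?j = ?T y ?j ?j"
    using dir_deriv_commute[OF rpoly_dir_deriv[OF assms(1)], of ?j y ?j] by simp
  moreover have "?T ?j ?j y = ?T y ?j ?j"
    using calculation dir_deriv_commute[OF assms(1), of ?j y] by simp
  ultimately show ?thesis using neg by (simp add: dS)
qed

lemma pluriharmonic_local_quadratic:
  fixes \<Omega> :: "(complex^'n) set"
  assumes ph: "lagrangian_pluriharmonic \<Omega> h" and \<Omega>: "open \<Omega>" "a \<in> \<Omega>"
  shows "\<exists>r>0. \<exists>\<l> Q. ball a r \<subseteq> \<Omega> \<and> linear \<l> \<and> traceless_hermitian Q \<and>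
    (\<forall>y. norm y < r \<longrightarrow> h (a + y) = h a + \<l> y + Q y y / 2)"
proof -
  have psh: "lagrangian_psh \<Omega> (\<lambda>z. ereal (h z))" "lagrangian_psh \<Omega> (\<lambda>z. ereal (- h z))"
    and cont: "continuous_on \<Omega> h" using ph by (auto simp: lagrangian_pluriharmonic_def)
  obtain R where R: "R > 0" "cball a R \<subseteq> \<Omega>" using \<Omega> open_contains_cball by blast
  define d where "d = R / 5"
  have d: "d > 0" and sub: "cball a (5 * d) \<subseteq> \<Omega>" using R by (auto simp: d_def)
  have hc: "continuous_on (cball a (5 * d)) h" using cont sub continuous_on_subset by blast
  have "ball a (5 * d) \<subseteq> \<Omega>" using sub ball_subset_cball by blast
  from psh_imp_visc_subharmonic[OF psh(1) this] psh_imp_visc_subharmonic[OF psh(2) this]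
  have "\<exists>v. harmonic_poly v \<and> (\<forall>x\<in>cball a (5 * d). \<bar>h x - v x\<bar> \<le> \<delta>)" if "\<delta> > 0" for \<delta>
    using harmonic_approx[OF _ hc _ _ that] d by simp
  then have "\<forall>k. \<exists>v. harmonic_poly v \<and> (\<forall>x\<in>cball a (5 * d). \<bar>h x - v x\<bar> \<le> inverse (real (Suc k)))"
    by (simp del: of_nat_Suc)
  then obtain v where harm: "\<And>k. harmonic_poly (v k)"
    and app: "\<And>k x. x \<in> cball a (5 * d) \<Longrightarrow> \<bar>h x - v k x\<bar> \<le> inverse (real (Suc k))" by metis
  have rv: "rpoly (v k)" for k using harm by (simp add: harmonic_poly_def)
  have lim: "uniform_limit (cball a (5 * d)) v h sequentially"
    unfolding uniform_limit_iff
  proof (intro allI impI)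
    fix e :: real assume "e > 0"
    from order_tendstoD(2)[OF LIMSEQ_inverse_real_of_nat this]
    show "\<forall>\<^sub>F k in sequentially. \<forall>x\<in>cball a (5 * d). dist (v k x) (h x) < e"
    proof (rule eventually_mono, intro ballI)
      fix k x assume k: "inverse (real (Suc k)) < e" and "x \<in> cball a (5 * d)"
      then show "dist (v k x) (h x) < e" using app[of x k] by (simp add: dist_real_def abs_minus_commute)
    qed
  qed
  obtain M0 where "\<forall>y\<in>h ` cball a (5 * d). norm y \<le> M0"
    using compact_imp_bounded[OF compact_continuous_image[OF hc compact_cball]]
    unfolding bounded_iff by blast
  then have M0: "\<bar>h x\<bar> \<le> M0" if "x \<in> cball a (5 * d)" for x using that by simp
  have M: "\<bar>v k x\<bar> \<le> M0 + 1" if "x \<in> cball a (5 * d)" for k x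
  proof -
    have "inverse (real (Suc k)) \<le> 1" by (simp add: inverse_le_1_iff)
    then show ?thesis using app[OF that, of k] M0[OF that] by linarith
  qed
  \<comment> \<open>The jet is taken at every point of the small ball and not only at
    \<open>a\<close>: J-invariance has to hold on a neighbourhood before it can be
    differentiated.\<close>
  have jet: "\<exists>\<l> Q. linear \<l> \<and> traceless_hermitian Q \<and> (\<forall>y. (\<lambda>k. dir_deriv y (v k) x) \<longlonglongrightarrow> \<l> y) \<and>
    (\<forall>y z. (\<lambda>k. dir_deriv y (dir_deriv z (v k)) x) \<longlonglongrightarrow> Q y z)" if x: "x \<in> cball a d" for x
  proof -
    obtain \<l> Q C where l: "linear \<l>" and Q: "Q \<in> Sym2"
      and lims: "\<forall>y. (\<lambda>k. dir_deriv y (v k) x) \<longlonglongrightarrow> \<l> y"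
        "\<forall>y z. (\<lambda>k. dir_deriv y (dir_deriv z (v k)) x) \<longlonglongrightarrow> Q y z"
      and bd: "\<And>y. norm y \<le> d \<Longrightarrow> \<bar>h (x + y) - h x - \<l> y - Q y y / 2\<bar> \<le> C * norm y ^ 3"
      using second_order_jet_limit[OF harm d lim M x] by blast
    have x\<Omega>: "x \<in> \<Omega>" using x sub d by force
    have "Q \<in> P_LAG"
    proof (rule psh_second_order_jet[OF psh(1) \<Omega>(1) x\<Omega> l Q d])
      show "h (x + y) \<le> h x + \<l> y + Q y y / 2 + C * norm y ^ 3" if "norm y < d" for y
        using bd[of y] that by linarith
    qed
    moreover have "(\<lambda>v w. - Q v w) \<in> P_LAG"
    proof (rule psh_second_order_jet[OF psh(2) \<Omega>(1) x\<Omega> _ _ d])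
      show "linear (\<lambda>y. - \<l> y)" using l by (rule linear_compose_neg)
      show "(\<lambda>v w. - Q v w) \<in> Sym2"
        using Q by (auto simp: Sym2_def bilinear_def intro: linear_compose_neg)
      show "- h (x + y) \<le> - h x + - \<l> y + - Q y y / 2 + C * norm y ^ 3" if "norm y < d" for y
        using bd[of y] that by linarith
    qed
    ultimately show ?thesis using P_LAG_both_traceless_hermitian l lims by blast
  qed
  \<comment> \<open>The defect of J-invariance of the Hessian of \<open>v k\<close>, itself a
    harmonic polynomial in x.\<close>
  define S where "S = (\<lambda>b c k x. dir_deriv b (dir_deriv c (v k)) x
      - dir_deriv (cplx_J b) (dir_deriv (cplx_J c) (v k)) x)"
  have harmS: "harmonic_poly (S b c k)" for b c k
    unfolding S_def by (intro harmonic_poly_diff harmonic_poly_dir_deriv harm)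
  have S0: "uniform_limit (cball a d) (S b c) (\<lambda>x. 0) sequentially" for b c
  proof -
    have ul: "\<exists>l. uniform_limit (cball a d) (\<lambda>k. dir_deriv b (dir_deriv c (v k))) l sequentially" for b c
    proof -
      obtain l' where "uniform_limit (cball a (4 * d)) (\<lambda>k. dir_deriv c (v k)) l' sequentially"
        using uniform_limit_dir_deriv_harmonic[where w="v" and a=a and r="4 * d"
            and d="d" and l=h and e=c] harm lim d by auto
      then show ?thesis
        using uniform_limit_dir_deriv_harmonic[where w="\<lambda>k. dir_deriv c (v k)" and a=a and r="d"
            and d="3 * d" and l=l' and e=b] harmonic_poly_dir_deriv[OF harm] d
        by auto
    qed
    obtain l1 l2 where "uniform_limit (cball a d) (\<lambda>k. dir_deriv b (dir_deriv c (v k))) l1 sequentially"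
      "uniform_limit (cball a d) (\<lambda>k. dir_deriv (cplx_J b) (dir_deriv (cplx_J c) (v k))) l2 sequentially"
      using ul by blast
    from uniform_limit_minus[OF this]
    have l: "uniform_limit (cball a d) (S b c) (\<lambda>x. l1 x - l2 x) sequentially"
      by (simp add: S_def[abs_def])
    \<comment> \<open>The Cauchy argument yields some uniform limit; its value at each point is read
      off from the J-invariant jet there.\<close>
    have "l1 x - l2 x = 0" if x: "x \<in> cball a d" for x
    proof -
      obtain Q where Q: "traceless_hermitian Q"
        "\<forall>y z. (\<lambda>k. dir_deriv y (dir_deriv z (v k)) x) \<longlonglongrightarrow> Q y z"
        using jet[OF x] by blast
      have "(\<lambda>k. S b c k x) \<longlonglongrightarrow> Q b c - Q (cplx_J b) (cplx_J c)"
        unfolding S_def using Q(2) by (intro tendsto_diff) auto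
      moreover have "Q b c - Q (cplx_J b) (cplx_J c) = 0"
        using Q(1) by (simp add: traceless_hermitian_def)
      ultimately show ?thesis
        using LIMSEQ_unique[OF tendsto_uniform_limitI[OF l x]] by simp
    qed
    then show ?thesis
      using l by (subst uniform_limit_cong'[of _ _ "S b c" _ "\<lambda>x. l1 x - l2 x"]) auto
  qed
  have dS: "uniform_limit (cball a (d / 2)) (\<lambda>k. dir_deriv g (S b c k)) (\<lambda>x. 0) sequentially" for g b c
    using uniform_limit_dir_deriv_harmonic_0[where w="S b c" and a=a and r="d / 2" and d="d / 2" and e=g] S0 d harmS by simp
  have third: "uniform_limit (cball a (d / 2)) (\<lambda>k. dir_deriv y (dir_deriv y (dir_deriv y (v k))))
      (\<lambda>x. 0) sequentially" for y
  proof -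
    have "uniform_limit (cball a (d / 2))
        (\<lambda>k x. dir_deriv y (S y y k) x + (1/2) * dir_deriv (cplx_J y) (S y (cplx_J y) k) x)
        (\<lambda>x. 0 + (1/2) * 0) sequentially"
      by (intro uniform_limit_intros dS)
    moreover have "(\<lambda>k x. dir_deriv y (S y y k) x + (1/2) * dir_deriv (cplx_J y) (S y (cplx_J y) k) x)
        = (\<lambda>k. dir_deriv y (dir_deriv y (dir_deriv y (v k))))"
      using third_derivative_J[OF rv] by (simp add: S_def fun_eq_iff)
    ultimately show ?thesis by simp
  qed
  obtain \<l> Q where lQ: "linear \<l>" "traceless_hermitian Q"
    and lims: "\<And>y. (\<lambda>k. dir_deriv y (v k) a) \<longlonglongrightarrow> \<l> y"
      "\<And>y z. (\<lambda>k. dir_deriv y (dir_deriv z (v k)) a) \<longlonglongrightarrow> Q y z"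
    using jet[of a] d by auto
  have "h (a + y) = h a + \<l> y + Q y y / 2" if y: "norm y < d / 2" for y
  proof (rule rpoly_taylor_limit[OF rv _ _ lims])
    show "(\<lambda>k. v k a) \<longlonglongrightarrow> h a" "(\<lambda>k. v k (a + y)) \<longlonglongrightarrow> h (a + y)"
      using d y by (auto intro!: tendsto_uniform_limitI[OF lim] simp: dist_norm)
    show "uniform_limit (cball a (norm y)) (\<lambda>k. dir_deriv y (dir_deriv y (dir_deriv y (v k))))
        (\<lambda>x. 0) sequentially"
      by (rule uniform_limit_on_subset[OF third]) (use y in \<open>auto simp: subset_cball\<close>)
  qed
  moreover have "ball a (d / 2) \<subseteq> \<Omega>" using sub d by (auto simp: subset_iff)
  ultimately show ?thesis using lQ d by (intro exI[of _ "d / 2"]) auto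
qed

section \<open>Smooth test functions, and the passage from local to global\<close>

lemma smooth_on_dir_deriv:
  fixes f :: "'a::euclidean_space \<Rightarrow> real"
  assumes "smooth_on f U"
  shows "smooth_on (dir_deriv v f) U" "x \<in> U \<Longrightarrow> f differentiable (at x)" "continuous_on U f"
proof -
  have Ck: "Ck_on k f U" for k using assms by (simp add: smooth_on_def)
  have "Ck_on k (dir_deriv v f) U" for k
    using Ck[of "Suc k"] by (simp add: dir_deriv_def[abs_def])
  then show "smooth_on (dir_deriv v f) U" by (simp add: smooth_on_def)
  show "f differentiable (at x)" if "x \<in> U" using Ck[of "Suc 0"] that by simp
  show "continuous_on U f" using Ck[of 0] by simp
qed

text \<open>The mean value theorem is applied first along \<open>v\<close> and then along
  \<open>w\<close>. The left-hand side is symmetric in the two directions, which is what the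
  symmetry of second derivatives rests on.\<close>

lemma mixed_difference:
  fixes f :: "'a::euclidean_space \<Rightarrow> real"
  assumes f: "smooth_on f U" and h: "h > 0"
    and U: "\<And>s t. 0 \<le> s \<Longrightarrow> s \<le> h \<Longrightarrow> 0 \<le> t \<Longrightarrow> t \<le> h \<Longrightarrow> x + s *\<^sub>R v + t *\<^sub>R w \<in> U"
  shows "\<exists>s t. 0 < s \<and> s < h \<and> 0 < t \<and> t < h \<and>
    f (x + h *\<^sub>R v + h *\<^sub>R w) - f (x + h *\<^sub>R v) - f (x + h *\<^sub>R w) + f x
      = h * (h * dir_deriv w (dir_deriv v f) (x + s *\<^sub>R v + t *\<^sub>R w))"
proof -
  have D: "((\<lambda>s. g (y + s *\<^sub>R u)) has_real_derivative dir_deriv u g (y + s *\<^sub>R u)) (at s)"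
    if "smooth_on g U" "y + s *\<^sub>R u \<in> U" for g y u s
    by (rule DERIV_along_line[OF has_derivative_dir_deriv[OF smooth_on_dir_deriv(2)[OF that]]])
  define g where "g = (\<lambda>s. f ((x + h *\<^sub>R w) + s *\<^sub>R v) - f (x + s *\<^sub>R v))"
  have "\<exists>s>0. s < h \<and> g h - g 0 =
      (h - 0) * (dir_deriv v f ((x + h *\<^sub>R w) + s *\<^sub>R v) - dir_deriv v f (x + s *\<^sub>R v))"
  proof (rule MVT2[OF h])
    fix s assume s: "0 \<le> s" "s \<le> h"
    show "(g has_real_derivative dir_deriv v f ((x + h *\<^sub>R w) + s *\<^sub>R v) - dir_deriv v f (x + s *\<^sub>R v)) (at s)"
      unfolding g_def
      using U[OF s, of h] U[OF s, of 0] h by (intro DERIV_diff D[OF f]) (simp_all add: algebra_simps)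
  qed
  then obtain s where s: "0 < s" "s < h" and gs: "g h - g 0 =
      h * (dir_deriv v f ((x + h *\<^sub>R w) + s *\<^sub>R v) - dir_deriv v f (x + s *\<^sub>R v))" by auto
  have "\<exists>t>0. t < h \<and> dir_deriv v f ((x + s *\<^sub>R v) + h *\<^sub>R w) - dir_deriv v f ((x + s *\<^sub>R v) + 0 *\<^sub>R w) =
      (h - 0) * dir_deriv w (dir_deriv v f) ((x + s *\<^sub>R v) + t *\<^sub>R w)"
    by (rule MVT2[OF h], rule D[OF smooth_on_dir_deriv(1)[OF f]]) (use U s in auto)
  then obtain t where t: "0 < t" "t < h" and "dir_deriv v f ((x + s *\<^sub>R v) + h *\<^sub>R w) - dir_deriv v f (x + s *\<^sub>R v) =
      h * dir_deriv w (dir_deriv v f) (x + s *\<^sub>R v + t *\<^sub>R w)" by auto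
  with gs have "g h - g 0 = h * (h * dir_deriv w (dir_deriv v f) (x + s *\<^sub>R v + t *\<^sub>R w))"
    by (simp add: add.commute add.left_commute)
  moreover have "g h - g 0 = f (x + h *\<^sub>R v + h *\<^sub>R w) - f (x + h *\<^sub>R v) - f (x + h *\<^sub>R w) + f x"
    by (simp add: g_def add.commute add.left_commute)
  ultimately show ?thesis using s t by (intro exI[of _ s] exI[of _ t]) simp
qed

text \<open>The two expressions of one mixed difference give equal values of the two mixed
  derivatives at points near \<open>x\<close>; continuity excludes a gap at \<open>x\<close>
  itself.\<close>

lemma dir_deriv_commute_smooth:
  fixes f :: "'a::euclidean_space \<Rightarrow> real"
  assumes f: "smooth_on f U" and U: "open U" "x \<in> U"
  shows "dir_deriv w (dir_deriv v f) x = dir_deriv v (dir_deriv w f) x"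
proof (rule ccontr)
  assume ne: "\<not> ?thesis"
  define e where "e = \<bar>dir_deriv w (dir_deriv v f) x - dir_deriv v (dir_deriv w f) x\<bar> / 2"
  have e: "e > 0" using ne by (simp add: e_def)
  have c: "\<exists>r>0. \<forall>z. dist z x < r \<longrightarrow> \<bar>dir_deriv w (dir_deriv v f) z - dir_deriv w (dir_deriv v f) x\<bar> < e" for v w
  proof -
    have "continuous_on U (dir_deriv w (dir_deriv v f))"
      by (intro smooth_on_dir_deriv(3) smooth_on_dir_deriv(1) f)
    then have "continuous (at x) (dir_deriv w (dir_deriv v f))"
      using U continuous_on_eq_continuous_at by blast
    then show ?thesis using e unfolding continuous_at_eps_delta dist_real_def by blast
  qed
  obtain r0 where r0: "r0 > 0" "\<And>z. dist z x < r0 \<Longrightarrow> z \<in> U" using U open_dist by metis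
  obtain r1 where r1: "r1 > 0" "\<And>z. dist z x < r1 \<Longrightarrow>
    \<bar>dir_deriv w (dir_deriv v f) z - dir_deriv w (dir_deriv v f) x\<bar> < e" using c by blast
  obtain r2 where r2: "r2 > 0" "\<And>z. dist z x < r2 \<Longrightarrow>
    \<bar>dir_deriv v (dir_deriv w f) z - dir_deriv v (dir_deriv w f) x\<bar> < e" using c by blast
  define r where "r = min r0 (min r1 r2)"
  have r: "r > 0" "r \<le> r0" "r \<le> r1" "r \<le> r2" using r0 r1 r2 by (auto simp: r_def)
  define n where "n = norm v + norm w + 1"
  have n: "n > 0" by (simp add: n_def add_nonneg_pos)
  \<comment> \<open>The parallelogram with sides h v and h w then stays within r/2 of
    \<open>x\<close>.\<close>
  define h where "h = r / (2 * n)"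
  have h: "h > 0" using r n by (simp add: h_def)
  have near: "dist (x + s *\<^sub>R v + t *\<^sub>R w) x < r" if "0 \<le> s" "s \<le> h" "0 \<le> t" "t \<le> h" for s t
  proof -
    have "norm (s *\<^sub>R v + t *\<^sub>R w) \<le> norm (s *\<^sub>R v) + norm (t *\<^sub>R w)" by (rule norm_triangle_ineq)
    also have "\<dots> \<le> h * norm v + h * norm w"
      using that by (simp add: add_mono mult_right_mono)
    also have "\<dots> \<le> h * n" using h by (simp add: n_def algebra_simps)
    also have "\<dots> < r" using r n by (simp add: h_def)
    finally show ?thesis by (simp add: dist_norm add.assoc)
  qed
  have near': "dist (x + s *\<^sub>R w + t *\<^sub>R v) x < r" if "0 \<le> s" "s \<le> h" "0 \<le> t" "t \<le> h" for s t
    using near[OF that(3,4,1,2)] by (simp add: algebra_simps)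
  have U1: "x + s *\<^sub>R v + t *\<^sub>R w \<in> U" if "0 \<le> s" "s \<le> h" "0 \<le> t" "t \<le> h" for s t
    using near[OF that] r0(2) r(2) by force
  have U2: "x + s *\<^sub>R w + t *\<^sub>R v \<in> U" if "0 \<le> s" "s \<le> h" "0 \<le> t" "t \<le> h" for s t
    using near'[OF that] r0(2) r(2) by force
  obtain s t where st: "0 < s" "s < h" "0 < t" "t < h" and
    1: "f (x + h *\<^sub>R v + h *\<^sub>R w) - f (x + h *\<^sub>R v) - f (x + h *\<^sub>R w) + f x
      = h * (h * dir_deriv w (dir_deriv v f) (x + s *\<^sub>R v + t *\<^sub>R w))"
    using mixed_difference[OF f h U1] by blast
  obtain s' t' where st': "0 < s'" "s' < h" "0 < t'" "t' < h" and
    2: "f (x + h *\<^sub>R w + h *\<^sub>R v) - f (x + h *\<^sub>R w) - f (x + h *\<^sub>R v) + f x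
      = h * (h * dir_deriv v (dir_deriv w f) (x + s' *\<^sub>R w + t' *\<^sub>R v))"
    using mixed_difference[OF f h U2] by blast
  have "x + h *\<^sub>R w + h *\<^sub>R v = x + h *\<^sub>R v + h *\<^sub>R w" by simp
  with 1 2[unfolded this] have "h * (h * dir_deriv w (dir_deriv v f) (x + s *\<^sub>R v + t *\<^sub>R w))
    = h * (h * dir_deriv v (dir_deriv w f) (x + s' *\<^sub>R w + t' *\<^sub>R v))" by linarith
  then have "dir_deriv w (dir_deriv v f) (x + s *\<^sub>R v + t *\<^sub>R w) = dir_deriv v (dir_deriv w f) (x + s' *\<^sub>R w + t' *\<^sub>R v)"
    using h by simp
  moreover have "\<bar>dir_deriv w (dir_deriv v f) (x + s *\<^sub>R v + t *\<^sub>R w) - dir_deriv w (dir_deriv v f) x\<bar> < e"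
    using near[of s t] st r by (intro r1(2)) auto
  moreover have "\<bar>dir_deriv v (dir_deriv w f) (x + s' *\<^sub>R w + t' *\<^sub>R v) - dir_deriv v (dir_deriv w f) x\<bar> < e"
    using near'[of s' t'] st' r by (intro r2(2)) auto
  ultimately show False
    using dist_triangle_half_r[of "dir_deriv w (dir_deriv v f) (x + s *\<^sub>R v + t *\<^sub>R w)"
        "dir_deriv w (dir_deriv v f) x" "2 * e" "dir_deriv v (dir_deriv w f) x"]
    by (simp add: e_def dist_real_def)
qed

text \<open>A derivative is linear in its direction, which gives linearity in the second argument;
  symmetry transfers it to the first. Membership in \<open>Sym2\<close> is part of membership in
  \<open>P_LAG\<close>.\<close>

lemma second_derivative_Sym2:
  fixes f :: "'a::euclidean_space \<Rightarrow> real"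
  assumes f: "smooth_on f U" and U: "open U" "x \<in> U"
  shows "second_derivative f x \<in> Sym2"
proof -
  have sym: "second_derivative f x v w = second_derivative f x w v" for v w
    unfolding second_derivative_eq by (rule dir_deriv_commute_smooth[OF f U])
  have lin: "linear (second_derivative f x v)" for v
    unfolding second_derivative_eq[abs_def]
    by (rule has_derivative_linear[OF has_derivative_dir_deriv[OF
          smooth_on_dir_deriv(2)[OF smooth_on_dir_deriv(1)[OF f] U(2)]]])
  have "linear (\<lambda>v. second_derivative f x v w)" for w
    using lin[of w] by (simp add: sym[of _ w])
  with lin sym show ?thesis by (auto simp: Sym2_def bilinear_def)
qed

lemma quadratic_psh:
  fixes \<Omega> :: "(complex^'n) set"
  assumes l: "linear \<l>" and Q: "traceless_hermitian Q"
    and h: "\<And>z. z \<in> \<Omega> \<Longrightarrow> h z = c + \<l> z + Q z z / 2"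
  shows "continuous_on \<Omega> h" "lagrangian_psh \<Omega> (\<lambda>z. ereal (h z))"
proof -
  have QS: "Q \<in> Sym2" using Q by (simp add: traceless_hermitian_def)
  \<comment> \<open>\<open>h\<close> is prescribed on \<Omega> only, so the derivatives are taken of
    this globally defined polynomial.\<close>
  define q where "q = (\<lambda>z. c + \<l> z + Q z z / 2)"
  have q: "rpoly q" and q'': "second_derivative q x v w = Q v w" for x v w
    using rpoly_quadratic[OF l QS, of c 0] second_derivative_quadratic[OF l QS, of c 0]
    by (simp_all add: q_def)
  show cont: "continuous_on \<Omega> h"
    using rpoly_continuous_on[OF q] h continuous_on_cong[of \<Omega> \<Omega> h q] by (simp add: q_def)
  have usc: "upper_semicontinuous_on \<Omega> (\<lambda>z. ereal (h z))"
    unfolding upper_semicontinuous_on_def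
  proof (intro ballI allI impI)
    fix x a assume "x \<in> \<Omega>" "ereal (h x) < a"
    moreover have "((\<lambda>z. ereal (h z)) \<longlongrightarrow> ereal (h x)) (at x within \<Omega>)"
      using cont \<open>x \<in> \<Omega>\<close> by (intro tendsto_intros) (auto simp: continuous_on_def)
    ultimately show "\<forall>\<^sub>F y in at x within \<Omega>. ereal (h y) < a" by (intro order_tendstoD(2))
  qed
  have "second_derivative \<phi> x \<in> P_LAG"
    if U: "open U" "x \<in> U" "U \<subseteq> \<Omega>" and \<phi>: "smooth_on \<phi> U" and le: "\<forall>y\<in>U. h y \<le> \<phi> y" and eq: "h x = \<phi> x"
    for x U \<phi>
  proof -
    have S: "second_derivative \<phi> x \<in> Sym2" by (rule second_derivative_Sym2[OF \<phi> U(1,2)])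
    have ge: "Q v v \<le> second_derivative \<phi> x v v" for v
    proof -
      obtain d where d: "d > 0" and inU: "\<And>t. \<bar>t\<bar> < d \<Longrightarrow> x + t *\<^sub>R v \<in> U"
        using segment_in_open[OF U(1,2)] by blast
      have "dir_deriv v (dir_deriv v \<phi>) x - dir_deriv v (dir_deriv v q) x \<ge> 0"
      proof (rule second_derivative_test[OF d, of "\<lambda>t. \<phi> (x + t *\<^sub>R v) - q (x + t *\<^sub>R v)"])
        show "\<phi> (x + 0 *\<^sub>R v) - q (x + 0 *\<^sub>R v) \<le> \<phi> (x + t *\<^sub>R v) - q (x + t *\<^sub>R v)" if "\<bar>t\<bar> < d" for t
        proof -
          have "x \<in> \<Omega>" "x + t *\<^sub>R v \<in> \<Omega>" using U inU[OF that] by auto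
          then have "h x = q x" "h (x + t *\<^sub>R v) = q (x + t *\<^sub>R v)" using h by (auto simp: q_def)
          then show ?thesis using le[rule_format, OF inU[OF that]] eq by simp
        qed
        show "((\<lambda>t. \<phi> (x + t *\<^sub>R v) - q (x + t *\<^sub>R v)) has_real_derivative
            dir_deriv v \<phi> (x + t *\<^sub>R v) - dir_deriv v q (x + t *\<^sub>R v)) (at t)" if "\<bar>t\<bar> < d" for t
          by (intro DERIV_diff rpoly_DERIV_along_line[OF q]
              DERIV_along_line has_derivative_dir_deriv smooth_on_dir_deriv(2)[OF \<phi>] inU that)
        have "((\<lambda>t. dir_deriv v \<phi> (x + t *\<^sub>R v)) has_real_derivative
            dir_deriv v (dir_deriv v \<phi>) (x + 0 *\<^sub>R v)) (at 0)"
          using U by (intro DERIV_along_line has_derivative_dir_deriv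
              smooth_on_dir_deriv(2)[OF smooth_on_dir_deriv(1)[OF \<phi>]]) simp
        from DERIV_diff[OF this rpoly_DERIV_along_line[OF rpoly_dir_deriv[OF q]]]
        show "((\<lambda>t. dir_deriv v \<phi> (x + t *\<^sub>R v) - dir_deriv v q (x + t *\<^sub>R v)) has_real_derivative
            dir_deriv v (dir_deriv v \<phi>) x - dir_deriv v (dir_deriv v q) x) (at 0)" by simp
      qed
      then show ?thesis using q''[of x v v] by (simp add: second_derivative_eq)
    qed
    have "trace_on W (second_derivative \<phi> x) \<ge> 0" if W: "W \<in> LAG" for W
    proof -
      obtain B where B: "lagrangian_basis B" "orthonormal_basis_of W B"
        using LAG_imp_lagrangian_basis[OF W] by blast
      have "0 = (\<Sum>e\<in>B. Q e e)" using traceless_hermitian_trace_on_LAG[OF Q B(1)] by simp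
      also have "\<dots> \<le> (\<Sum>e\<in>B. second_derivative \<phi> x e e)" by (intro sum_mono ge)
      also have "\<dots> = trace_on W (second_derivative \<phi> x)"
        using S B(2) by (simp add: trace_on_eq Sym2_def)
      finally show ?thesis .
    qed
    then show ?thesis using S by (simp add: P_LAG_def)
  qed
  then show "lagrangian_psh \<Omega> (\<lambda>z. ereal (h z))"
    using usc unfolding lagrangian_psh_def by (simp, blast)
qed

lemma traceless_hermitian_neg:
  assumes "traceless_hermitian Q"
  shows "traceless_hermitian (\<lambda>v w. - Q v w)"
proof -
  have Q: "bilinear Q" "\<And>v w. Q v w = Q w v" "\<And>v w. Q (cplx_J v) (cplx_J w) = Q v w"
    "(\<Sum>b\<in>Basis. Q b b) = 0"
    using assms by (auto simp: traceless_hermitian_def Sym2_def)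
  have "bilinear (\<lambda>v w. - Q v w)"
    using Q(1) by (simp add: bilinear_def linear_compose_neg)
  then show ?thesis
    using Q(2) by (simp add: traceless_hermitian_def Sym2_def Q(3,4) sum_negf)
qed

lemma quadratic_pluriharmonic:
  fixes \<Omega> :: "(complex^'n) set"
  assumes l: "linear \<l>" and Q: "traceless_hermitian Q"
    and h: "\<And>z. z \<in> \<Omega> \<Longrightarrow> h z = c + \<l> z + Q z z / 2"
  shows "lagrangian_pluriharmonic \<Omega> h"
proof -
  have "lagrangian_psh \<Omega> (\<lambda>z. ereal (- h z))"
    by (rule quadratic_psh(2)[OF linear_compose_neg[OF l] traceless_hermitian_neg[OF Q], of _ _ "- c"])
       (simp add: h)
  then show ?thesis
    using quadratic_psh[OF l Q h] by (simp add: lagrangian_pluriharmonic_def)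
qed

section \<open>Patching the local polynomials together\<close>

text \<open>A coordinate-free form of the target functions, as functions on the whole space, so that
  local representations of \<open>h\<close> can be compared as equal functions.\<close>

definition traceless_hermitian_poly :: "(complex^'n \<Rightarrow> real) \<Rightarrow> bool"
  where "traceless_hermitian_poly p \<longleftrightarrow>
    (\<exists>c \<l> Q. linear \<l> \<and> traceless_hermitian Q \<and> p = (\<lambda>z. c + \<l> z + Q z z / 2))"

text \<open>Recentring at the origin alters only the constant and linear parts, so the same
  \<open>Q\<close> serves.\<close>

lemma traceless_hermitian_poly_translate:
  assumes l: "linear \<l>" and Q: "traceless_hermitian Q"
  shows "traceless_hermitian_poly (\<lambda>z. c + \<l> (z - a) + Q (z - a) (z - a) / 2)"
proof -
  have bil: "bilinear Q" and sym: "\<And>v w. Q v w = Q w v"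
    using Q by (auto simp: traceless_hermitian_def Sym2_def)
  have "linear (\<lambda>z. \<l> z + - Q a z)"
    using bil by (intro linear_compose_add l linear_compose_neg) (simp add: bilinear_def)
  moreover have "(\<lambda>z. c + \<l> (z - a) + Q (z - a) (z - a) / 2) =
      (\<lambda>z. (c - \<l> a + Q a a / 2) + (\<l> z + - Q a z) + Q z z / 2)"
  proof
    fix z
    show "c + \<l> (z - a) + Q (z - a) (z - a) / 2 = (c - \<l> a + Q a a / 2) + (\<l> z + - Q a z) + Q z z / 2"
      using sym[of z a]
      by (simp add: linear_diff[OF l] bilinear_lsub[OF bil] bilinear_rsub[OF bil] field_simps)
  qed
  ultimately show ?thesis using Q unfolding traceless_hermitian_poly_def by blast
qed

lemma traceless_hermitian_poly_along_line:
  assumes "traceless_hermitian_poly p"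
  shows "\<exists>\<alpha> \<beta> \<gamma>. \<forall>t. p (a + t *\<^sub>R y) = \<alpha> + \<beta> * t + \<gamma> * t\<^sup>2"
proof -
  obtain c \<l> Q where l: "linear \<l>" and Q: "traceless_hermitian Q" and p: "p = (\<lambda>z. c + \<l> z + Q z z / 2)"
    using assms by (auto simp: traceless_hermitian_poly_def)
  have bil: "bilinear Q" using Q by (auto simp: traceless_hermitian_def Sym2_def)
  show ?thesis
    by (rule exI[of _ "c + \<l> a + Q a a / 2"], rule exI[of _ "\<l> y + (Q a y + Q y a) / 2"],
        rule exI[of _ "Q y y / 2"])
       (simp add: p linear_add[OF l] linear_cmul[OF l] bilinear_ladd[OF bil] bilinear_radd[OF bil]
        bilinear_lmul[OF bil] bilinear_rmul[OF bil] power2_eq_square field_simps)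
qed

text \<open>On the line from \<open>a\<close> through \<open>z\<close> both functions are quadratic
  in the parameter; their values at 0 and at two small opposite parameters fix the coefficients,
  hence the value at parameter 1.\<close>

lemma traceless_hermitian_poly_unique:
  assumes p: "traceless_hermitian_poly p" and q: "traceless_hermitian_poly q"
    and U: "open U" "a \<in> U" "\<And>z. z \<in> U \<Longrightarrow> p z = q z"
  shows "p = q"
proof
  fix z
  obtain r where r: "r > 0" "ball a r \<subseteq> U" using U openE by blast
  define y where "y = z - a"
  define n where "n = norm y + 1"
  define t where "t = r / (2 * n)"
  have ny: "n > 0" by (simp add: n_def add_nonneg_pos)
  have t: "t > 0" using r ny by (simp add: t_def)
  have "t * norm y \<le> t * n" using t by (simp add: n_def)
  also have "\<dots> = r / 2" using ny by (simp add: t_def)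
  also have "\<dots> < r" using r by simp
  finally have "t * norm y < r" .
  then have inU: "a + s *\<^sub>R y \<in> U" if "s \<in> {0, t, -t}" for s
    using r that t by (auto simp: dist_norm)
  obtain \<alpha> \<beta> \<gamma> \<alpha>' \<beta>' \<gamma>' where P: "\<And>t. p (a + t *\<^sub>R y) = \<alpha> + \<beta> * t + \<gamma> * t\<^sup>2"
    and Q: "\<And>t. q (a + t *\<^sub>R y) = \<alpha>' + \<beta>' * t + \<gamma>' * t\<^sup>2"
    using traceless_hermitian_poly_along_line[OF p] traceless_hermitian_poly_along_line[OF q] by metis
  have eq: "\<alpha> + \<beta> * s + \<gamma> * s\<^sup>2 = \<alpha>' + \<beta>' * s + \<gamma>' * s\<^sup>2" if "s \<in> {0, t, -t}" for s
    using U(3)[OF inU[OF that]] P[of s] Q[of s] by simp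
  have "\<alpha> = \<alpha>'" using eq[of 0] by simp
  have "\<beta> * t = \<beta>' * t" "\<gamma> * t\<^sup>2 = \<gamma>' * t\<^sup>2"
  proof -
    have "\<beta> * t + \<gamma> * t\<^sup>2 = \<beta>' * t + \<gamma>' * t\<^sup>2" "- (\<beta> * t) + \<gamma> * t\<^sup>2 = - (\<beta>' * t) + \<gamma>' * t\<^sup>2"
      using eq[of t] eq[of "-t"] \<open>\<alpha> = \<alpha>'\<close> by simp_all
    then show "\<beta> * t = \<beta>' * t" "\<gamma> * t\<^sup>2 = \<gamma>' * t\<^sup>2" by linarith+
  qed
  then have "\<beta> = \<beta>'" "\<gamma> = \<gamma>'" using t by auto
  then show "p z = q z" using P[of 1] Q[of 1] \<open>\<alpha> = \<alpha>'\<close> by (simp add: y_def)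
qed

text \<open>The polynomial attached to a centre is locally constant in that centre: for a centre
  inside another ball the two balls overlap in a nonempty open set, where both polynomials equal
  \<open>h\<close>.\<close>

lemma pluriharmonic_traceless_hermitian_poly:
  fixes \<Omega> :: "(complex^'n) set"
  assumes ph: "lagrangian_pluriharmonic \<Omega> h" and \<Omega>: "open \<Omega>" "connected \<Omega>" "\<Omega> \<noteq> {}"
  shows "\<exists>p. traceless_hermitian_poly p \<and> (\<forall>z\<in>\<Omega>. h z = p z)"
proof -
  have "\<exists>r>0. \<exists>p. traceless_hermitian_poly p \<and> ball a r \<subseteq> \<Omega> \<and> (\<forall>z\<in>ball a r. h z = p z)" if a: "a \<in> \<Omega>" for a
  proof -
    obtain r \<l> Q where r: "r > 0" "ball a r \<subseteq> \<Omega>" and lQ: "linear \<l>" "traceless_hermitian Q"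
      and eq: "\<And>y. norm y < r \<Longrightarrow> h (a + y) = h a + \<l> y + Q y y / 2"
      using pluriharmonic_local_quadratic[OF ph \<Omega>(1) a] by blast
    have "h z = h a + \<l> (z - a) + Q (z - a) (z - a) / 2" if "z \<in> ball a r" for z
      using eq[of "z - a"] that by (simp add: dist_norm norm_minus_commute)
    then show ?thesis using r traceless_hermitian_poly_translate[OF lQ, of "h a" a] by blast
  qed
  then obtain p r where r: "\<And>a. a \<in> \<Omega> \<Longrightarrow> r a > 0" "\<And>a. a \<in> \<Omega> \<Longrightarrow> ball a (r a) \<subseteq> \<Omega>"
    and p: "\<And>a. a \<in> \<Omega> \<Longrightarrow> traceless_hermitian_poly (p a)"
    and hp: "\<And>a z. a \<in> \<Omega> \<Longrightarrow> z \<in> ball a (r a) \<Longrightarrow> h z = p a z" by metis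
  have loc: "p a = p b" if a: "a \<in> \<Omega>" and b: "b \<in> ball a (r a)" for a b
  proof -
    have b\<Omega>: "b \<in> \<Omega>" using r(2)[OF a] b by blast
    show ?thesis
    proof (rule traceless_hermitian_poly_unique[OF p[OF a] p[OF b\<Omega>]])
      show "open (ball a (r a) \<inter> ball b (r b))" "b \<in> ball a (r a) \<inter> ball b (r b)"
        using r(1)[OF b\<Omega>] b by auto
      show "p a z = p b z" if "z \<in> ball a (r a) \<inter> ball b (r b)" for z
        using hp[OF a, of z] hp[OF b\<Omega>, of z] that by (metis IntE)
    qed
  qed
  obtain a where a: "a \<in> \<Omega>" using \<Omega>(3) by blast
  have "p a = p b" if b: "b \<in> \<Omega>" for b
  proof (rule connected_local_const[OF \<Omega>(2) a b], intro ballI)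
    fix c assume c: "c \<in> \<Omega>"
    have "\<forall>\<^sub>F z in nhds c. z \<in> ball c (r c)"
      by (rule eventually_nhds_in_open) (use r(1)[OF c] in auto)
    then show "\<forall>\<^sub>F z in at c within \<Omega>. p c = p z"
      unfolding eventually_at_filter by (rule eventually_mono) (use loc[OF c] in blast)
  qed
  then have "h b = p a b" if "b \<in> \<Omega>" for b
    using hp[OF that, of b] r(1)[OF that] that by simp
  then show ?thesis using p[OF a] by blast
qed

section \<open>The matrix form\<close>

lemma Basis_complex_vec_cases:
  assumes "b \<in> (Basis :: (complex^'n) set)"
  obtains k where "b = axis k 1" | k where "b = axis k \<i>"
  using assms by (auto simp: Basis_vec_def Basis_complex_def)

lemma cplx_J_axis: "cplx_J (axis k 1) = axis k \<i>" "cplx_J (axis k \<i>) = - axis k 1"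
  by (auto simp: cplx_J_def axis_def vec_eq_iff)

lemma hermitian_matrix_iff:
  "A = transpose (map_matrix cnj A) \<longleftrightarrow> (\<forall>i j. A $ i $ j = cnj (A $ j $ i))"
  by (simp add: vec_eq_iff transpose_def map_matrix_def)

definition hermitian_form :: "complex^'n^'n \<Rightarrow> complex^'n \<Rightarrow> complex^'n \<Rightarrow> complex"
  where "hermitian_form A v w = (\<Sum>i\<in>UNIV. \<Sum>j\<in>UNIV. A $ i $ j * v $ i * cnj (w $ j))"

lemma cnj_hermitian_form:
  assumes "A = transpose (map_matrix cnj A)"
  shows "cnj (hermitian_form A v w) = hermitian_form A w v"
proof -
  have A: "cnj (A $ i $ j) = A $ j $ i" for i j
    using assms unfolding hermitian_matrix_iff by metis
  have "cnj (hermitian_form A v w) = (\<Sum>i\<in>UNIV. \<Sum>j\<in>UNIV. A $ j $ i * w $ j * cnj (v $ i))"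
    by (simp add: hermitian_form_def A mult_ac)
  also have "\<dots> = hermitian_form A w v"
    unfolding hermitian_form_def by (rule sum.swap)
  finally show ?thesis .
qed

lemma hermitian_form_axis: "hermitian_form A (axis k u) (axis l w) = A $ k $ l * u * cnj w"
proof -
  have "hermitian_form A (axis k u) (axis l w) =
      (\<Sum>i\<in>UNIV. \<Sum>j\<in>UNIV. if j = l then (if i = k then A $ i $ j * u * cnj w else 0) else 0)"
    unfolding hermitian_form_def by (intro sum.cong) (auto simp: axis_def)
  then show ?thesis by simp
qed

lemma bilinear_Re_hermitian_form: "bilinear (\<lambda>v w. Re (hermitian_form A v w))"
  unfolding bilinear_def
proof (intro conjI allI linearI)
  have "hermitian_form A x (y + z) = hermitian_form A x y + hermitian_form A x z" for x y z
    by (simp add: hermitian_form_def distrib_left sum.distrib)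
  then show "Re (hermitian_form A x (y + z)) = Re (hermitian_form A x y) + Re (hermitian_form A x z)" for x y z
    by simp
  have "hermitian_form A (y + z) x = hermitian_form A y x + hermitian_form A z x" for x y z
    by (simp add: hermitian_form_def distrib_left distrib_right sum.distrib)
  then show "Re (hermitian_form A (y + z) x) = Re (hermitian_form A y x) + Re (hermitian_form A z x)" for x y z
    by simp
  have 1: "hermitian_form A x (c *\<^sub>R y) = c *\<^sub>R hermitian_form A x y" for x c y
    by (simp add: hermitian_form_def scaleR_right.sum)
  then show "Re (hermitian_form A x (c *\<^sub>R y)) = c *\<^sub>R Re (hermitian_form A x y)" for x c y
    by simp
  have 2: "hermitian_form A (c *\<^sub>R y) x = c *\<^sub>R hermitian_form A y x" for x c y
    by (simp add: hermitian_form_def scaleR_right.sum)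
  then show "Re (hermitian_form A (c *\<^sub>R y) x) = c *\<^sub>R Re (hermitian_form A y x)" for x c y
    by simp
qed

lemma hermitian_form_cplx_J: "hermitian_form A (cplx_J v) (cplx_J w) = hermitian_form A v w"
  unfolding hermitian_form_def by (intro sum.cong) (simp_all add: cplx_J_def mult_ac)

lemma sum_range_axis: "(\<Sum>e\<in>range (\<lambda>k::'n::finite. axis k (1::complex)). f e) = (\<Sum>k\<in>UNIV. f (axis k 1))"
proof -
  have "inj (\<lambda>k::'n. axis k (1::complex))" by (auto simp: inj_def axis_eq_axis)
  then show ?thesis by (simp add: sum.reindex)
qed

lemma traceless_hermitian_hermitian_form:
  assumes A: "A = transpose (map_matrix cnj A)" and tr: "trace A = 0"
  shows "traceless_hermitian (\<lambda>v w. Re (hermitian_form A v w))"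
proof -
  let ?Q = "\<lambda>v w. Re (hermitian_form A v w)"
  have bil: "bilinear ?Q" by (rule bilinear_Re_hermitian_form)
  have "?Q v w = ?Q w v" for v w
    using arg_cong[OF cnj_hermitian_form[OF A, of v w], of Re] by simp
  moreover have "(\<Sum>b\<in>Basis. ?Q b b) = 2 * Re (trace A)"
    unfolding sum_Basis_lagrangian_basis[OF lagrangian_basis_axis bil] sum_range_axis
    by (simp add: hermitian_form_cplx_J hermitian_form_axis trace_def)
  ultimately show ?thesis
    using bil tr by (simp add: traceless_hermitian_def Sym2_def hermitian_form_cplx_J)
qed

lemma traceless_hermitian_matrix:
  fixes Q :: "complex^'n \<Rightarrow> complex^'n \<Rightarrow> real"
  assumes Q: "traceless_hermitian Q"
  shows "\<exists>A. A = transpose (map_matrix cnj A) \<and> trace A = 0 \<and> Q = (\<lambda>v w. Re (hermitian_form A v w))"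
proof -
  have bil: "bilinear Q" and sym: "\<And>v w. Q v w = Q w v"
    and J: "\<And>v w. Q (cplx_J v) (cplx_J w) = Q v w"
    using Q by (auto simp: traceless_hermitian_def Sym2_def)
  \<comment> \<open>Since the second slot is conjugated, pairing e_i with i e_j multiplies the entry
    by -i, and the real part becomes its imaginary part. J-invariance makes that part antisymmetric,
    hence \<open>A\<close> hermitian.\<close>
  define A :: "complex^'n^'n" where
    "A = (\<chi> i j. Complex (Q (axis i 1) (axis j 1)) (Q (axis i 1) (axis j \<i>)))"
  have q: "Q (axis i \<i>) (axis j \<i>) = Q (axis i 1) (axis j 1)"
    "Q (axis i \<i>) (axis j 1) = - Q (axis i 1) (axis j \<i>)" for i j
    using J[of "axis i 1" "axis j 1"] J[of "axis i 1" "axis j \<i>"]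
    by (simp_all add: cplx_J_axis bilinear_rneg[OF bil])
  have q': "Q (axis i 1) (axis j \<i>) = - Q (axis j 1) (axis i \<i>)" for i j
    using q(2)[of j i] sym[of "axis j \<i>" "axis i 1"] by simp
  have herm: "A = transpose (map_matrix cnj A)"
    unfolding hermitian_matrix_iff
  proof (intro allI)
    fix i j
    show "A $ i $ j = cnj (A $ j $ i)"
      using sym[of "axis i 1" "axis j 1"] q'[of i j] by (simp add: A_def complex_eq_iff)
  qed
  have "Im (trace A) = 0"
    using q'[of k k for k] by (simp add: trace_def A_def)
  \<comment> \<open>The real part is the trace of \<open>Q\<close> on the Lagrangian plane of real
    vectors.\<close>
  moreover have "Re (trace A) = 0"
    using traceless_hermitian_trace_on_LAG[OF Q lagrangian_basis_axis]
    unfolding sum_range_axis by (simp add: trace_def A_def)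
  ultimately have "trace A = 0" by (simp add: complex_eq_iff)
  moreover have "Q = (\<lambda>v w. Re (hermitian_form A v w))"
  proof (rule bilinear_eq_stdbasis[OF bil bilinear_Re_hermitian_form])
    fix i j :: "complex^'n" assume "i \<in> Basis" "j \<in> Basis"
    then show "Q i j = Re (hermitian_form A i j)"
      by (elim Basis_complex_vec_cases) (simp_all add: hermitian_form_axis A_def q)
  qed
  ultimately show ?thesis using herm by blast
qed

lemma linear_complex_vec:
  fixes \<l> :: "complex^'n \<Rightarrow> real"
  assumes "linear \<l>"
  shows "\<exists>b. \<l> = (\<lambda>z. Re (\<Sum>k\<in>UNIV. b $ k * z $ k + cnj (b $ k) * cnj (z $ k)))"
proof -
  \<comment> \<open>Each summand below is twice the real part of b_k z_k; evaluating at e_k and i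
    e_k forces b_k to be the Wirtinger derivative of the linear function with respect to
    z_k.\<close>
  define b :: "complex^'n" where "b = (\<chi> k. Complex (\<l> (axis k 1) / 2) (- \<l> (axis k \<i>) / 2))"
  have "linear (\<lambda>z. Re (\<Sum>k\<in>UNIV. b $ k * z $ k + cnj (b $ k) * cnj (z $ k)))"
    by (rule linearI) (simp_all add: algebra_simps sum.distrib sum_distrib_left)
  then have "\<l> = (\<lambda>z. Re (\<Sum>k\<in>UNIV. b $ k * z $ k + cnj (b $ k) * cnj (z $ k)))"
  proof (rule linear_eq_stdbasis[OF assms])
    fix e :: "complex^'n" assume "e \<in> Basis"
    moreover have "(\<Sum>k\<in>UNIV. b $ k * axis l u $ k + cnj (b $ k) * cnj (axis l u $ k)) =
        b $ l * u + cnj (b $ l) * cnj u" for l u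
    proof -
      have "(\<Sum>k\<in>UNIV. b $ k * axis l u $ k + cnj (b $ k) * cnj (axis l u $ k)) =
        (\<Sum>k\<in>UNIV. if k = l then b $ k * u + cnj (b $ k) * cnj u else 0)"
        by (intro sum.cong) (auto simp: axis_def)
      then show ?thesis by simp
    qed
    ultimately show "\<l> e = Re (\<Sum>k\<in>UNIV. b $ k * e $ k + cnj (b $ k) * cnj (e $ k))"
      by (elim Basis_complex_vec_cases) (simp_all add: b_def)
  qed
  then show ?thesis by blast
qed

theorem theorem4p1:
  fixes \<Omega> :: "(complex^'n) set" and h :: "complex^'n \<Rightarrow> real"
  assumes "open \<Omega>" and "connected \<Omega>"
  shows "lagrangian_pluriharmonic \<Omega> h \<longleftrightarrow>
    (\<exists>(c::real) (b::complex^'n) (A::complex^'n^'n).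
      A = transpose (map_matrix cnj A) \<and> trace A = 0 \<and>
      (\<forall>z\<in>\<Omega>. complex_of_real (h z) =
        complex_of_real c + (\<Sum>k\<in>UNIV. b $ k * z $ k + cnj (b $ k) * cnj (z $ k))
        + 1/2 * (\<Sum>i\<in>UNIV. \<Sum>j\<in>UNIV. A $ i $ j * z $ i * cnj (z $ j))))"
    (is "_ \<longleftrightarrow> (\<exists>c b A. ?P c b A)")
proof
  assume ph: "lagrangian_pluriharmonic \<Omega> h"
  obtain p where p: "traceless_hermitian_poly p" "\<And>z. z \<in> \<Omega> \<Longrightarrow> h z = p z"
  proof (cases "\<Omega> = {}")
    \<comment> \<open>The empty set is open and connected, and any polynomial of the required form
      will do there; the zero polynomial is supplied.\<close>
    case True
    have "traceless_hermitian (\<lambda>v w. Re (hermitian_form (0::complex^'n^'n) v w))"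
      by (rule traceless_hermitian_hermitian_form)
         (simp_all add: hermitian_matrix_iff trace_def)
    then have "traceless_hermitian_poly (\<lambda>z::complex^'n. 0 + 0 + Re (hermitian_form 0 z z) / 2)"
      unfolding traceless_hermitian_poly_def using linear_zero by blast
    then show ?thesis using True that by blast
  qed (use pluriharmonic_traceless_hermitian_poly[OF ph assms] that in blast)
  then obtain c \<l> Q where l: "linear \<l>" and Q: "traceless_hermitian Q"
    and h: "\<And>z. z \<in> \<Omega> \<Longrightarrow> h z = c + \<l> z + Q z z / 2"
    by (auto simp: traceless_hermitian_poly_def)
  obtain b where b: "\<l> = (\<lambda>z. Re (\<Sum>k\<in>UNIV. b $ k * z $ k + cnj (b $ k) * cnj (z $ k)))"
    using linear_complex_vec[OF l] by blast
  obtain A where A: "A = transpose (map_matrix cnj A)" "trace A = 0"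
    and QA: "Q = (\<lambda>v w. Re (hermitian_form A v w))"
    using traceless_hermitian_matrix[OF Q] by blast
  have "complex_of_real (h z) =
        complex_of_real c + (\<Sum>k\<in>UNIV. b $ k * z $ k + cnj (b $ k) * cnj (z $ k))
        + 1/2 * hermitian_form A z z" if "z \<in> \<Omega>" for z
  proof -
    \<comment> \<open>The claim is an equation between complex numbers, so besides the real parts
      both the quadratic and the linear term have to be shown real.\<close>
    have "Im (hermitian_form A z z) = 0"
      using arg_cong[OF cnj_hermitian_form[OF A(1), of z z], of Im] by simp
    moreover define L where "L = (\<Sum>k\<in>UNIV. b $ k * z $ k + cnj (b $ k) * cnj (z $ k))"
    moreover have "Im L = 0" by (simp add: L_def)
    moreover have "h z = c + Re L + Re (hermitian_form A z z) / 2"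
      using h[OF that] unfolding b QA L_def .
    ultimately show ?thesis unfolding L_def[symmetric] by (simp add: complex_eq_iff)
  qed
  then show "\<exists>c b A. ?P c b A"
    using A unfolding hermitian_form_def by blast
next
  assume "\<exists>c b A. ?P c b A"
  then obtain c b A where A: "A = transpose (map_matrix cnj A)" "trace A = 0"
    and h: "\<And>z. z \<in> \<Omega> \<Longrightarrow> complex_of_real (h z) =
        complex_of_real c + (\<Sum>k\<in>UNIV. b $ k * z $ k + cnj (b $ k) * cnj (z $ k))
        + 1/2 * hermitian_form A z z"
    unfolding hermitian_form_def by blast
  have "linear (\<lambda>z. Re (\<Sum>k\<in>UNIV. b $ k * z $ k + cnj (b $ k) * cnj (z $ k)))"
    by (rule linearI) (simp_all add: algebra_simps sum.distrib sum_distrib_left)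
  then show "lagrangian_pluriharmonic \<Omega> h"
  proof (rule quadratic_pluriharmonic[OF _ traceless_hermitian_hermitian_form[OF A]])
    fix z assume "z \<in> \<Omega>"
    from arg_cong[OF h[OF this], of Re]
    show "h z = c + Re (\<Sum>k\<in>UNIV. b $ k * z $ k + cnj (b $ k) * cnj (z $ k))
        + Re (hermitian_form A z z) / 2"
      by (simp del: Re_sum)
  qed
qed

end
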